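(* Let $d=2$ and $s=1$. Then $$\limsup_{N\to\infty}\ (\ln N)\,\kappa_N^{(2)}\leq 4.$$
   Context: Points of $\mathbb{R}^{2N}$ are written $X=(X_1,\ldots,X_N)$ with $X_n\in\mathbb{R}^2$, and $\nabla_n$ is the gradient with respect to $X_n$. $\dot H^1(\mathbb{R}^{2N})$ is the homogeneous Sobolev space, i.e. the completion of $C_c^\infty(\mathbb{R}^{2N})$ with respect to $\sum_{n=1}^N\int_{\mathbb{R}^{2N}}|\nabla_n u|^2\,dX$. A function $u$ on $\mathbb{R}^{2N}$ is antisymmetric if for every permutation $\sigma$ of $\{1,\ldots,N\}$ and a.e. $X$ one has $u(X_1,\ldots,X_N)=(\operatorname{sgn}\sigma)\,u(X_{\sigma(1)},\ldots,X_{\sigma(N)})$. For $N\geq 2$, $$\kappa_N^{(2)}:=\inf_{\substack{0\neq u\in\dot H^1(\mathbb{R}^{2N})\\ u\ \text{antisymmetric}}}\frac{\sum_{n=1}^N\int_{\mathbb{R}^{2N}}|\nabla_n u(X)|^2\,dX}{\sum_{1\leq n<m\leq N}\int_{\mathbb{R}^{2N}}\frac{|u(X)|^2}{|X_n-X_m|^2}\,dX}.$$ *)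

theory Defs
  imports "HOL-Analysis.Analysis"
begin

text \<open>
  Points of \<open>\<real>\<^sup>2\<^sup>N\<close> are extensional functions \<open>X\<close> on \<open>{..<N}\<close> with values in \<open>real^2\<close>,
  the particle indices running from \<open>0\<close> to \<open>N - 1\<close>. This keeps \<open>N\<close> an ordinary variable, which is
  needed for the limit in \<open>N\<close>. The function-space topology restricted to \<open>config_space N\<close> is the
  Euclidean one, and \<open>config_measure N\<close> is Lebesgue measure.
\<close>

type_synonym config = "nat \<Rightarrow> real^2"

definition config_space :: "nat \<Rightarrow> config set" where
  "config_space N = PiE {..<N} (\<lambda>_. UNIV)"

definition config_measure :: "nat \<Rightarrow> config measure" where
  "config_measure N = Pi\<^sub>M {..<N} (\<lambda>_. lborel)"

definition shift :: "nat \<Rightarrow> 2 \<Rightarrow> real \<Rightarrow> config \<Rightarrow> config" where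
  "shift n j t X = X(n := X n + t *\<^sub>R axis j 1)"

definition partial_deriv :: "nat \<times> 2 \<Rightarrow> (config \<Rightarrow> complex) \<Rightarrow> config \<Rightarrow> complex" where
  "partial_deriv = (\<lambda>(n, j) f X. vector_derivative (\<lambda>t. f (shift n j t X)) (at 0))"

definition iter_partial :: "(nat \<times> 2) list \<Rightarrow> (config \<Rightarrow> complex) \<Rightarrow> config \<Rightarrow> complex" where
  "iter_partial ds f = foldr partial_deriv ds f"

text \<open>
  Being \<open>C\<^sup>\<infinity>\<close> means that all iterated partial derivatives, in any order of the coordinates, exist
  and are continuous.
\<close>

definition smooth_config :: "nat \<Rightarrow> (config \<Rightarrow> complex) \<Rightarrow> bool" where
  "smooth_config N f \<longleftrightarrow>
     (\<forall>ds. set ds \<subseteq> {..<N} \<times> UNIV \<longrightarrow>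
        continuous_on (config_space N) (iter_partial ds f) \<and>
        (\<forall>X\<in>config_space N. \<forall>n<N. \<forall>j.
           (\<lambda>t. iter_partial ds f (shift n j t X)) differentiable (at 0)))"

definition test_function :: "nat \<Rightarrow> (config \<Rightarrow> complex) \<Rightarrow> bool" where
  "test_function N f \<longleftrightarrow>
     smooth_config N f \<and>
     (\<exists>K. compact K \<and> K \<subseteq> config_space N \<and> (\<forall>X\<in>config_space N - K. f X = 0))"

definition particle_grad :: "nat \<Rightarrow> (config \<Rightarrow> complex) \<Rightarrow> config \<Rightarrow> complex^2" where
  "particle_grad n f X = (\<chi> j. partial_deriv (n, j) f X)"

definition grad_energy :: "nat \<Rightarrow> (nat \<Rightarrow> config \<Rightarrow> complex^2) \<Rightarrow> ennreal" where
  "grad_energy N G = (\<Sum>n<N. \<integral>\<^sup>+X. ennreal ((norm (G n X))\<^sup>2) \<partial>config_measure N)"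

text \<open>
  \<open>hom_sobolev N u G\<close>: the function \<open>u\<close> belongs to the homogeneous Sobolev space, the completion of
  the test functions in the gradient norm, and \<open>G n\<close> is its weak gradient in the \<open>n\<close>-th particle.
  For \<open>N \<ge> 2\<close> the Sobolev inequality identifies the elements of the completion with locally
  integrable functions: a Cauchy sequence \<open>\<phi>\<close> of test functions represents its limit \<open>u\<close> in
  \<open>L\<^sup>1\<^sub>l\<^sub>o\<^sub>c\<close>. Requiring this convergence is essential, since convergence of the gradients alone
  would also admit \<open>u + c\<close> for constants \<open>c\<close>. The gradient \<open>G\<close> is determined by \<open>u\<close> almost
  everywhere.
\<close>

definition hom_sobolev ::
    "nat \<Rightarrow> (config \<Rightarrow> complex) \<Rightarrow> (nat \<Rightarrow> config \<Rightarrow> complex^2) \<Rightarrow> bool" where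
  "hom_sobolev N u G \<longleftrightarrow>
     u \<in> borel_measurable (config_measure N) \<and>
     (\<forall>n<N. G n \<in> borel_measurable (config_measure N)) \<and>
     (\<exists>\<phi> :: nat \<Rightarrow> config \<Rightarrow> complex.
        (\<forall>k. test_function N (\<phi> k)) \<and>
        (\<lambda>k. grad_energy N (\<lambda>n X. particle_grad n (\<phi> k) X - G n X)) \<longlonglongrightarrow> 0 \<and>
        (\<forall>K. compact K \<and> K \<subseteq> config_space N \<longrightarrow>
           (\<lambda>k. \<integral>\<^sup>+X\<in>K. ennreal (norm (\<phi> k X - u X)) \<partial>config_measure N) \<longlonglongrightarrow> 0))"

definition antisymmetric :: "nat \<Rightarrow> (config \<Rightarrow> complex) \<Rightarrow> bool" where
  "antisymmetric N u \<longleftrightarrow>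
     (\<forall>\<sigma>. \<sigma> permutes {..<N} \<longrightarrow>
        (AE X in config_measure N. u X = of_int (sign \<sigma>) * u (X \<circ> \<sigma>)))"

definition hardy_term :: "nat \<Rightarrow> (config \<Rightarrow> complex) \<Rightarrow> ennreal" where
  "hardy_term N u =
     (\<Sum>(n, m)\<in>{(n, m). n < m \<and> m < N}.
        \<integral>\<^sup>+X. ennreal ((norm (u X))\<^sup>2 / (norm (X n - X m))\<^sup>2) \<partial>config_measure N)"

text \<open>
  For \<open>N \<ge> 2\<close> the denominator is nonzero because \<open>u\<close> is; in \<open>ennreal\<close> a quotient with
  finite numerator and infinite denominator is \<open>0\<close>.
\<close>

definition kappa :: "nat \<Rightarrow> ennreal" where
  "kappa N = Inf {grad_energy N G / hardy_term N u | u G.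
     hom_sobolev N u G \<and> antisymmetric N u \<and> \<not> (AE X in config_measure N. u X = 0)}"

end

theory Submission
  imports Defs "HOL-Real_Asymp.Real_Asymp"
begin

text \<open>
  The trial state is a Slater determinant of smooth orbitals living in the unit squares of a large
  square grid, a fixed number \<open>n\<close> of them in each square. Within a square the orbitals are products
  of \<open>g t * exp (2 pi i k h t)\<close> with \<open>h' = g^2\<close>, \<open>g\<close> supported in the unit interval and
  \<open>\<integral> g^2 = 1\<close>. The substitution \<open>s = h t\<close> turns them into plane waves, so they are exactly
  orthonormal, and the energy of the \<open>k\<close>-th one is \<open>\<integral> g'^2 + 4 pi^2 k^2 \<integral> g^6\<close>, where the last
  integral is as close to \<open>1\<close> as we like. Taking the momenta in a disc, a square costs about
  \<open>2 pi n^2\<close>. Orbitals in different squares have disjoint supports, so there is no exchange term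
  between them; dropping the repulsion inside the squares, the Hardy term is at least half the sum of
  \<open>n^2 / (\<bar>b - c\<bar> + 2)^2\<close> over pairs of squares, that is about \<open>(pi / 2) n^2 ln N\<close> per square. The
  quotient of the two is \<open>4 / ln N\<close>.
\<close>

subsection \<open>Smooth functions of one variable\<close>

text \<open>Both constants come from comparing lattice sums with integrals. For momenta in a disc of
  radius R, n ~ pi R^2 and sum |k|^2 ~ pi R^4 / 2, hence 4 pi^2 sum |k|^2 ~ 2 pi n^2. The weights 1
  / |v|^2 over |v| \<le> L add up to about 2 pi ln L, and N ~ n (B L)^2 with n and B fixed makes
  this pi ln N. So the logarithm comes from the number of squares alone; n only has to be large
  enough to absorb \<integral> g'^2, which may be huge but enters linearly in n against n^2. The
  obstacle is that trial states must be smooth with compact support while norms of the determinant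
  should still be computed exactly. Product orbitals, any two of them orthogonal in some coordinate,
  settle this: integrals of squared determinants become sums over permutations, and the factor N!
  cancels in the quotient. Confining two particles to given squares only deletes orbitals at two
  positions, so it yields a determinant of the same kind; this makes the Hardy term countable. As
  the energy is needed from above and the Hardy term from below only, particles in excess of a full
  grid can go to fresh squares outside it.\<close>

primrec diff_times :: "nat \<Rightarrow> (real \<Rightarrow> 'a::real_normed_field) \<Rightarrow> bool" where
  "diff_times 0 f \<longleftrightarrow> continuous_on UNIV f"
| "diff_times (Suc k) f \<longleftrightarrow>
     (\<exists>f'. (\<forall>t. (f has_vector_derivative f' t) (at t)) \<and> diff_times k f')"

text \<open>Differentiability is counted by recursion on the order instead of through iterated
  derivatives, so each closure property is an induction on the order with the functions
  generalised.\<close>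

definition smooth :: "(real \<Rightarrow> 'a::real_normed_field) \<Rightarrow> bool" where
  "smooth f \<longleftrightarrow> (\<forall>k. diff_times k f)"

definition D1 :: "(real \<Rightarrow> 'a::real_normed_vector) \<Rightarrow> real \<Rightarrow> 'a" where
  "D1 f = (\<lambda>t. vector_derivative f (at t))"

lemma diff_times_imp_continuous:
  assumes "diff_times k f" shows "continuous_on UNIV f"
proof (cases k)
  case 0 then show ?thesis using assms by simp
next
  case (Suc l)
  then obtain f' where "\<forall>t. (f has_vector_derivative f' t) (at t)" using assms by auto
  then show ?thesis
    by (auto intro!: continuous_at_imp_continuous_on has_vector_derivative_continuous)
qed

lemma diff_times_Suc: "diff_times (Suc k) f \<Longrightarrow> diff_times k f"
proof (induction k arbitrary: f)
  case 0 then show ?case using diff_times_imp_continuous by fastforce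
next
  case (Suc k) 
  from Suc.prems obtain f' where "\<forall>t. (f has_vector_derivative f' t) (at t)" "diff_times (Suc k) f'"
    by (metis diff_times.simps(2))
  with Suc.IH show ?case by (metis diff_times.simps(2))
qed

lemma smooth_derivI:
  assumes "\<And>t. (f has_vector_derivative f' t) (at t)" "smooth f'"
  shows "smooth f"
  unfolding smooth_def
proof
  fix k
  have "diff_times (Suc k) f" using assms by (auto simp: smooth_def)
  then show "diff_times k f" by (rule diff_times_Suc)
qed

lemma smooth_has_deriv:
  assumes "smooth f"
  shows "(f has_vector_derivative D1 f t) (at t)"
proof -
  have "diff_times (Suc 0) f" using assms unfolding smooth_def by blast
  then obtain f' where "(f has_vector_derivative f' t) (at t)" by auto
  then show ?thesis
    using vector_derivative_at by (force simp: D1_def)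
qed

lemma smooth_D1:
  assumes "smooth f" shows "smooth (D1 f)"
  unfolding smooth_def
proof
  fix k
  have "diff_times (Suc k) f" using assms unfolding smooth_def by blast
  then obtain f' where f': "\<forall>t. (f has_vector_derivative f' t) (at t)" "diff_times k f'" by auto
  then have "D1 f = f'" by (auto simp: D1_def vector_derivative_at)
  then show "diff_times k (D1 f)" using f' by simp
qed

lemma smooth_continuous: "smooth f \<Longrightarrow> continuous_on A f"
  using diff_times_imp_continuous continuous_on_subset smooth_def by (metis top_greatest)

lemma diff_times_const: "diff_times k (\<lambda>t. c)"
  by (induction k arbitrary: c) (auto intro!: exI[of _ "\<lambda>t. 0"] derivative_eq_intros)

lemma smooth_const: "smooth (\<lambda>t. c)"
  by (simp add: smooth_def diff_times_const)

lemma diff_times_add: "diff_times k f \<Longrightarrow> diff_times k g \<Longrightarrow> diff_times k (\<lambda>t. f t + g t)"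
proof (induction k arbitrary: f g)
  case 0 then show ?case by (auto intro!: continuous_intros)
next
  case (Suc k)
  then obtain f' g' where "\<forall>t. (f has_vector_derivative f' t) (at t)" "diff_times k f'"
    "\<forall>t. (g has_vector_derivative g' t) (at t)" "diff_times k g'" by auto
  then show ?case using Suc.IH[of f' g']
    by (auto intro!: exI[of _ "\<lambda>t. f' t + g' t"] derivative_intros)
qed

lemma diff_times_mult: "diff_times k f \<Longrightarrow> diff_times k g \<Longrightarrow> diff_times k (\<lambda>t. f t * g t)"
proof (induction k arbitrary: f g)
  case 0 then show ?case by (auto intro!: continuous_intros)
next
  case (Suc k)
  then obtain f' g' where h: "\<forall>t. (f has_vector_derivative f' t) (at t)" "diff_times k f'"
    "\<forall>t. (g has_vector_derivative g' t) (at t)" "diff_times k g'" by auto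
  \<comment> \<open>The product rule reuses the undifferentiated factors, which are known at order
    \<open>Suc k\<close> and must be brought down to order \<open>k\<close>.\<close>
  have "diff_times k f" "diff_times k g" using Suc.prems diff_times_Suc by blast+
  then have "diff_times k (\<lambda>t. f t * g' t + f' t * g t)"
    using Suc.IH h by (intro diff_times_add) auto
  then show ?case using h
    by (auto intro!: exI[of _ "\<lambda>t. f t * g' t + f' t * g t"] has_vector_derivative_mult)
qed

lemma smooth_mult: "smooth f \<Longrightarrow> smooth g \<Longrightarrow> smooth (\<lambda>t. f t * g t)"
  by (simp add: smooth_def diff_times_mult)

lemma diff_times_affine: "diff_times k f \<Longrightarrow> diff_times k (\<lambda>t. f (a * t + b))"
proof (induction k arbitrary: f)
  case 0 then show ?case
    by (auto intro!: continuous_on_compose2[where s=UNIV and t=UNIV and g=f] continuous_intros)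
next
  case (Suc k)
  then obtain f' where h: "\<forall>t. (f has_vector_derivative f' t) (at t)" "diff_times k f'" by auto
  have "((\<lambda>t. f (a * t + b)) has_vector_derivative (of_real a * f' (a * t + b))) (at t)" for t
  proof -
    have "((\<lambda>t. a * t + b) has_vector_derivative a) (at t)"
      by (auto intro!: derivative_eq_intros simp: has_vector_derivative_def)
    from vector_diff_chain_at[OF this, of f "f' (a*t+b)"] h(1)
    show ?thesis by (simp add: o_def scaleR_conv_of_real)
  qed
  moreover have "diff_times k (\<lambda>t. of_real a * f' (a * t + b))"
    using Suc.IH[OF h(2)] diff_times_const by (intro diff_times_mult) auto
  ultimately show ?case
    unfolding diff_times.simps by (intro exI[of _ "\<lambda>t. of_real a * f' (a * t + b)"]) blast
qed

lemma smooth_affine: "smooth f \<Longrightarrow> smooth (\<lambda>t. f (a * t + b))"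
  by (simp add: smooth_def diff_times_affine)

lemma diff_times_of_real: "diff_times k f \<Longrightarrow> diff_times k (\<lambda>t. of_real (f t) :: 'a::real_normed_field)"
proof (induction k arbitrary: f)
  case 0 then show ?case by (auto intro!: continuous_intros)
next
  case (Suc k)
  then obtain f' where h: "\<forall>t. (f has_vector_derivative f' t) (at t)" "diff_times k f'" by auto
  then show ?case using Suc.IH[of f']
    by (auto intro!: exI[of _ "\<lambda>t. of_real (f' t)"] has_vector_derivative_of_real
        simp flip: has_real_derivative_iff_has_vector_derivative)
qed

lemma smooth_of_real: "smooth f \<Longrightarrow> smooth (\<lambda>t. of_real (f t) :: 'a::real_normed_field)"
  by (simp add: smooth_def diff_times_of_real)

lemma exp_vector_derivative:
  fixes f :: "real \<Rightarrow> 'a::{real_normed_field,banach}"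
  assumes "(f has_vector_derivative f') (at t)"
  shows "((\<lambda>t. exp (f t)) has_vector_derivative (f' * exp (f t))) (at t)"
proof -
  have "(exp has_field_derivative exp (f t)) (at (f t))" by (rule DERIV_exp)
  from field_vector_diff_chain_at[OF assms this] show ?thesis by (simp add: o_def)
qed

lemma smooth_exp:
  fixes f :: "real \<Rightarrow> 'a::{real_normed_field,banach}"
  assumes "smooth f" shows "smooth (\<lambda>t. exp (f t))"
  unfolding smooth_def
proof
  fix k show "diff_times k (\<lambda>t. exp (f t))"
  proof (induction k)
    case 0
    show ?case using smooth_continuous[OF assms] by (auto intro!: continuous_intros)
  next
    case (Suc k)
    \<comment> \<open>The derivative contains the exponential again, and the induction hypothesis is
      about this very function.\<close>
    have "diff_times k (\<lambda>t. D1 f t * exp (f t))"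
      using Suc smooth_D1[OF assms] by (intro diff_times_mult) (auto simp: smooth_def)
    then show ?case using exp_vector_derivative[OF smooth_has_deriv[OF assms]]
      unfolding diff_times.simps by (intro exI[of _ "\<lambda>t. D1 f t * exp (f t)"]) blast
  qed
qed

text \<open>The standard flat function together with its quotients by powers: differentiating
  \<open>exp (- 1 / t)\<close> creates the factor 1 / t^2, so the family indexed by \<open>m\<close>
  is closed under derivatives up to linear combinations.\<close>

definition flat :: "nat \<Rightarrow> real \<Rightarrow> real" where
  "flat m t = (if t \<le> 0 then 0 else exp (- 1 / t) / t ^ m)"

lemma flat_at_right: "(flat m \<longlongrightarrow> 0) (at_right 0)"
proof -
  have "((\<lambda>t::real. exp (- 1 / t) / t ^ m) \<longlongrightarrow> 0) (at_right 0)"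
  proof -
    have "((\<lambda>x::real. x ^ m / exp x) \<longlongrightarrow> 0) at_top" by (rule tendsto_power_div_exp_0)
    then have "((\<lambda>t::real. inverse t ^ m / exp (inverse t)) \<longlongrightarrow> 0) (at_right 0)"
      by (rule filterlim_compose[OF _ filterlim_inverse_at_top_right])
    then show ?thesis by (simp add: field_simps exp_minus)
  qed
  then show ?thesis
    by (rule Lim_transform_eventually) (auto simp: flat_def eventually_at_filter)
qed

lemma flat_at_0: "(flat m \<longlongrightarrow> 0) (at 0)"
proof -
  have "(flat m \<longlongrightarrow> 0) (at_left 0)"
    by (rule Lim_transform_eventually[OF tendsto_const]) (auto simp: flat_def eventually_at_filter)
  then show ?thesis using flat_at_right by (simp add: filterlim_at_split)
qed

lemma flat_deriv:
  "(flat m has_real_derivative (flat (m + 2) t - real m * flat (m + 1) t)) (at t)"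
proof -
  consider "t < 0" | "t = 0" | "t > 0" by linarith
  then show ?thesis
  proof cases
    case 1
    have "((\<lambda>t. 0) has_real_derivative 0) (at t)" by simp
    then have "(flat m has_real_derivative 0) (at t)"
      by (rule has_field_derivative_transform_within_open[where S="{..<0}"])
        (use 1 in \<open>auto simp: flat_def\<close>)
    then show ?thesis using 1 by (simp add: flat_def)
  next
    case 2
    \<comment> \<open>The difference quotient of \<open>flat m\<close> at 0 is
      \<open>flat (Suc m)\<close> itself, which tends to 0.\<close>
    have "((\<lambda>y. (flat m y - flat m 0) / (y - 0)) \<longlongrightarrow> 0) (at 0)"
      by (rule Lim_transform_eventually[OF flat_at_0[of "Suc m"]])
        (auto simp: flat_def eventually_at_filter)
    then have "(flat m has_real_derivative 0) (at 0)" by (simp add: has_field_derivative_iff)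
    then show ?thesis using 2 by (simp add: flat_def)
  next
    case 3
    have "((\<lambda>t. exp (- 1 / t) / t ^ m) has_real_derivative
       (exp (- 1 / t) / t ^ (m+2) - real m * (exp (- 1 / t) / t ^ (m+1)))) (at t)"
    proof -
      have "((\<lambda>t. exp (- 1 / t)) has_real_derivative exp (- 1 / t) * (1 / t\<^sup>2)) (at t)"
        using 3 by (auto intro!: derivative_eq_intros simp: power2_eq_square)
      moreover have "((\<lambda>t. t ^ m) has_real_derivative real m * t ^ (m - Suc 0)) (at t)"
        by (rule DERIV_pow)
      ultimately have "((\<lambda>t. exp (- 1 / t) / t ^ m) has_real_derivative
          (exp (- 1 / t) * (1 / t\<^sup>2) * t ^ m - exp (- 1 / t) * (real m * t ^ (m - Suc 0)))
            / (t ^ m * t ^ m)) (at t)"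
        using 3 by (intro DERIV_divide) auto
      moreover have "(e * (1 / t\<^sup>2) * t ^ m - e * (real m * t ^ (m - Suc 0))) / (t ^ m * t ^ m)
          = e / t ^ (m+2) - real m * (e / t ^ (m+1))" for e
      proof (cases m)
        case (Suc l)
        have "t ^ m = t * t ^ l" "t ^ (m - Suc 0) = t ^ l" "t ^ (m+2) = t * (t * (t * t ^ l))"
          "t ^ (m+1) = t * (t * t ^ l)" "t ^ l \<noteq> 0" using Suc 3 by auto
        then show ?thesis using 3 by (simp add: divide_simps power2_eq_square) (simp add: algebra_simps)
      qed (use 3 in \<open>simp add: power2_eq_square\<close>)
      ultimately show ?thesis by simp
    qed
    then have "(flat m has_real_derivative
       (exp (- 1 / t) / t ^ (m+2) - real m * (exp (- 1 / t) / t ^ (m+1)))) (at t)"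
      by (rule has_field_derivative_transform_within_open[where S="{0<..}"])
        (use 3 in \<open>auto simp: flat_def\<close>)
    then show ?thesis using 3 by (simp add: flat_def)
  qed
qed

lemma smooth_flat: "smooth (flat m)"
  unfolding smooth_def
proof
  fix k show "diff_times k (flat m)"
  proof (induction k arbitrary: m)
    case 0
    show ?case
      by (auto intro!: continuous_at_imp_continuous_on DERIV_isCont[OF flat_deriv])
  next
    case (Suc k)
    have "diff_times k (\<lambda>t. flat (m + 2) t + (- real m) * flat (m + 1) t)"
      using Suc diff_times_const by (intro diff_times_add diff_times_mult) auto
    then show ?case
      using flat_deriv[of m] 
      by (auto simp: has_real_derivative_iff_has_vector_derivative
          intro!: exI[of _ "\<lambda>t. flat (m + 2) t + (- real m) * flat (m + 1) t"])
  qed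
qed

subsection \<open>Orthonormal orbitals on the unit interval\<close>

lemma integrable_continuous_supported:
  fixes f :: "real \<Rightarrow> 'a::{banach,second_countable_topology}"
  assumes "continuous_on UNIV f" "\<And>t. t < a \<or> t > b \<Longrightarrow> f t = 0"
  shows "integrable lborel f"
proof -
  have "integrable lborel (\<lambda>x. indicator {a..b} x *\<^sub>R f x)"
    using assms(1) by (intro borel_integrable_compact) (auto intro: continuous_on_subset)
  moreover have "(\<lambda>x. indicator {a..b} x *\<^sub>R f x) = f"
    using assms(2) by (force simp: indicator_def)
  ultimately show ?thesis by simp
qed

lemma integral_FTC_supported:
  fixes f :: "real \<Rightarrow> 'a::euclidean_space"
  assumes "continuous_on UNIV f" "\<And>t. t < a \<or> t > b \<Longrightarrow> f t = 0" "a \<le> b"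
    and "\<And>t. (F has_vector_derivative f t) (at t)"
  shows "integral\<^sup>L lborel f = F b - F a"
proof -
  have "(\<integral>x. indicator {a..b} x *\<^sub>R f x \<partial>lborel) = F b - F a"
    using assms by (intro integral_FTC_Icc)
      (auto intro: has_vector_derivative_at_within continuous_on_subset)
  moreover have "(\<lambda>x. indicator {a..b} x *\<^sub>R f x) = f"
    using assms(2) by (force simp: indicator_def)
  ultimately show ?thesis by simp
qed

lemma antiderivative_continuous:
  fixes f :: "real \<Rightarrow> real"
  assumes "continuous_on UNIV f"
  shows "\<exists>F. \<forall>t. (F has_vector_derivative f t) (at t)"
proof -
  have "\<exists>F. \<forall>x::real. -\<infinity> < ereal x \<longrightarrow> ereal x < \<infinity> \<longrightarrow> (F has_vector_derivative f x) (at x)"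
    using assms by (intro einterval_antiderivative) (auto simp: continuous_on_eq_continuous_at)
  then show ?thesis by auto
qed

text \<open>On the unit interval \<integral> g^6 is at least 1 when \<integral> g^2 = 1, with
  equality for the indicator function, so g is a normalised smooth approximation \<open>G\<close> of
  that indicator. As \<open>G\<close> lies between 0 and 1, \<integral> G^6 is at most 1, and
  everything depends on keeping \<open>c\<close> = \<integral> G^2 close to 1.\<close>

lemma smooth_profile_exists:
  fixes \<eta> :: real
  assumes "\<eta> > 0"
  shows "\<exists>g. smooth g \<and> (\<forall>t. t \<le> 0 \<or> t \<ge> 1 \<longrightarrow> g t = (0::real)) \<and>
    (LBINT t. g t ^ 2) = 1 \<and> (LBINT t. g t ^ 6) \<le> 1 + \<eta>"
proof -
  \<comment> \<open>The bound obtained below is 1 / c^3 with c at least 1 - 6 s; this fixes how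
    small s has to be.\<close>
  have "((\<lambda>s::real. 1 / (1 - 6 * s) ^ 3) \<longlongrightarrow> 1 / (1 - 6 * 0) ^ 3) (at_right 0)"
    by (intro tendsto_intros) auto
  then have "\<forall>\<^sub>F s in at_right 0. 1 / (1 - 6 * s) ^ 3 < 1 + \<eta>"
    by (rule order_tendstoD) (use assms in auto)
  moreover have "\<forall>\<^sub>F s::real in at_right 0. s < 1/6"
    by (rule eventually_at_rightI[of 0 "1/6"]) auto
  moreover have "\<forall>\<^sub>F s::real in at_right 0. s > 0"
    by (simp add: eventually_at_filter)
  ultimately have "\<forall>\<^sub>F s in at_right 0. 1 / (1 - 6 * s) ^ 3 < 1 + \<eta> \<and> s < 1/6 \<and> s > 0"
    by eventually_elim auto
  then obtain s :: real where s: "1 / (1 - 6 * s) ^ 3 < 1 + \<eta>" "s < 1/6" "s > 0"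
    using eventually_happens[of _ "at_right (0::real)"] by auto
  \<comment> \<open>For 0 < t < 1 this is exp (- s^2 / t) * exp (- s^2 / (1 - t)), and on [s, 1 - s]
    both exponents are at least - s. The \<open>+ 0\<close> gives the argument the form expected by
    \<open>smooth_affine\<close>.\<close>
  define G where "G = (\<lambda>t. flat 0 (1 / s\<^sup>2 * t + 0) * flat 0 (-1 / s\<^sup>2 * t + 1 / s\<^sup>2))"
  have smG: "smooth G" unfolding G_def
    by (intro smooth_mult smooth_affine smooth_flat)
  have fl: "0 \<le> flat 0 t" "flat 0 t \<le> 1" for t by (auto simp: flat_def)
  have G01: "0 \<le> G t" "G t \<le> 1" for t
    using fl by (auto simp: G_def intro: mult_le_one)
  have G0: "G t = 0" if "t \<le> 0 \<or> t \<ge> 1" for t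
  proof -
    have "t \<ge> 1 \<Longrightarrow> -1 / s\<^sup>2 * t + 1 / s\<^sup>2 \<le> 0" using s by (simp add: field_simps)
    moreover have "t \<le> 0 \<Longrightarrow> 1 / s\<^sup>2 * t + 0 \<le> 0" using s by (simp add: field_simps)
    ultimately show ?thesis using that by (auto simp: G_def flat_def)
  qed
  have ctG: "continuous_on UNIV G" using smG by (rule smooth_continuous)
  have intG: "integrable lborel (\<lambda>t. G t ^ k)" if "k > 0" for k
    using that ctG G0
    by (intro integrable_continuous_supported[of _ 0 1]) (auto intro!: continuous_intros)
  define c where "c = (LBINT t. G t ^ 2)"
  have low: "G t ^ 2 \<ge> 1 - 4 * s" if "t \<in> {s..1-s}" for t
  proof -
    have t: "t > 0" "1 - t > 0" "t \<ge> s" "1 - t \<ge> s" using that s by auto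
    have "s * s \<le> s * t" "s * s \<le> s * (1 - t)" using t s by (auto intro!: mult_left_mono)
    then have "s\<^sup>2 / t \<le> s" "s\<^sup>2 / (1 - t) \<le> s" using t
      by (simp_all add: divide_le_eq power2_eq_square)
    moreover have "G t = exp (- (s\<^sup>2 / t)) * exp (- (s\<^sup>2 / (1 - t)))"
    proof -
      have e: "-1 / s\<^sup>2 * t + 1 / s\<^sup>2 = (1 - t) / s\<^sup>2" by (simp add: diff_divide_distrib)
      have "1 / s\<^sup>2 * t > 0" "(1 - t) / s\<^sup>2 > 0" using t s by auto
      then show ?thesis unfolding G_def e by (auto simp: flat_def)
    qed
    ultimately have "G t \<ge> exp (- 2 * s)" by (simp flip: exp_add)
    then have "G t ^ 2 \<ge> exp (- 2 * s) ^ 2" by (intro power_mono) auto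
    moreover have "exp (- 2 * s) ^ 2 = exp (- 4 * s)" by (simp flip: exp_double)
    moreover have "exp (- 4 * s) \<ge> 1 - 4 * s" using exp_ge_add_one_self[of "- 4 * s"] by simp
    ultimately show ?thesis by linarith
  qed
  have "(LBINT t. (1 - 4 * s) * indicator {s..1-s} t) \<le> c"
    unfolding c_def
  proof (intro integral_mono)
    show "integrable lborel (\<lambda>t. (1 - 4 * s) * indicator {s..1-s} t)"
      by (intro integrable_mult_right integrable_real_indicator) (use s in auto)
    show "integrable lborel (\<lambda>t. G t ^ 2)" by (rule intG) simp
    show "(1 - 4 * s) * indicator {s..1-s} t \<le> G t ^ 2" for t
      using low by (simp add: indicator_def)
  qed
  also have "(LBINT t. (1 - 4 * s) * indicator {s..1-s} t) = (1 - 4 * s) * (1 - 2 * s)"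
    using s by (simp add: measure_def)
  finally have "c \<ge> (1 - 4 * s) * (1 - 2 * s)" .
  moreover have "(1 - 4 * s) * (1 - 2 * s) \<ge> 1 - 6 * s" using s by (simp add: algebra_simps)
  ultimately have c: "c \<ge> 1 - 6 * s" by linarith
  then have c0: "c > 0" using s by linarith
  define g where "g = (\<lambda>t. (1 / sqrt c) * G t)"
  have smg: "smooth g" unfolding g_def by (intro smooth_mult smooth_const smG)
  have "(LBINT t. g t ^ 2) = 1"
    using c0 by (simp add: g_def power_mult_distrib power_divide flip: c_def)
  moreover have "(LBINT t. g t ^ 6) \<le> 1 + \<eta>"
  proof -
    have "(LBINT t. G t ^ 6) \<le> (LBINT t. indicator {0..1::real} t)"
    proof (rule integral_mono)
      show "integrable lborel (\<lambda>t. G t ^ 6)" by (rule intG) simp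
      show "G t ^ 6 \<le> indicat_real {0..1} t" for t
        using G01[of t] G0[of t] by (auto simp: indicator_def power_le_one)
    qed auto
    then have G6: "(LBINT t. G t ^ 6) \<le> 1" by simp
    have c6: "sqrt c ^ 6 = c ^ 3" proof -
      have "sqrt c ^ 6 = (sqrt c ^ 2) ^ 3" by (simp flip: power_mult)
      then show ?thesis using c0 by simp
    qed
    have "(LBINT t. g t ^ 6) = (LBINT t. G t ^ 6) / c ^ 3"
      by (simp add: g_def power_mult_distrib power_divide c6)
    also have "\<dots> \<le> 1 / c ^ 3" using G6 c0 by (intro divide_right_mono) auto
    also have "\<dots> \<le> 1 / (1 - 6 * s) ^ 3"
      using c s by (intro divide_left_mono power_mono) auto
    finally show ?thesis using s by linarith
  qed
  moreover have "\<forall>t. t \<le> 0 \<or> t \<ge> 1 \<longrightarrow> g t = 0" using G0 by (auto simp: g_def)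
  ultimately show ?thesis using smg by blast
qed

lemma D1_eq_0_outside:
  assumes "\<And>t. t \<le> a \<or> t \<ge> b \<Longrightarrow> f t = 0" "t < a \<or> t > b"
  shows "D1 f t = 0"
proof -
  have "(f has_vector_derivative 0) (at t)" if "open S" "t \<in> S" "\<And>x. x \<in> S \<Longrightarrow> f x = 0" for S
    by (rule has_vector_derivative_transform_within_open[OF has_vector_derivative_const that(1,2)])
      (simp add: that(3))
  from this[of "{..<a}"] this[of "{b<..}"] show ?thesis
    using assms by (auto simp: D1_def intro!: vector_derivative_at)
qed

text \<open>\<open>A\<close> stands for \<integral> g'^2 and depends on \<eta>. Since the functions
  vanish at 0 and 1 as well, the integer part of a point where a translate is nonzero determines the
  translate.\<close>

definition orbital_family :: "real \<Rightarrow> real \<Rightarrow> (int \<Rightarrow> real \<Rightarrow> complex) \<Rightarrow> bool" where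
  "orbital_family \<eta> A f \<longleftrightarrow>
     (\<forall>k. smooth (f k)) \<and> (\<forall>k t. t \<le> 0 \<or> t \<ge> 1 \<longrightarrow> f k t = 0) \<and>
     (\<forall>k l. (LBINT t. f k t * cnj (f l t)) = of_bool (k = l)) \<and>
     (\<forall>k. (LBINT t. (norm (D1 (f k) t))\<^sup>2) \<le> A + (1 + \<eta>) * 4 * pi\<^sup>2 * (of_int k)\<^sup>2)"

text \<open>Since h' = g^2, the product of \<open>f k\<close> with the conjugate of
  \<open>f l\<close> is g^2 * \<open>e (k - l)\<close>, which for k \<noteq> l is the derivative of
  \<open>e (k - l)\<close> over a constant. As h grows by exactly 1 across the interval,
  \<open>e (k - l)\<close> returns to its initial value and the integral is 0.\<close>

lemma orbital_family_exists:
  fixes \<eta> :: real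
  assumes "\<eta> > 0"
  shows "\<exists>A f. orbital_family \<eta> A f"
proof -
  obtain g :: "real \<Rightarrow> real" where g: "smooth g" "\<And>t. t \<le> 0 \<or> t \<ge> 1 \<Longrightarrow> g t = 0"
    "(LBINT t. g t ^ 2) = 1" "(LBINT t. g t ^ 6) \<le> 1 + \<eta>"
    using smooth_profile_exists[OF assms] by blast
  have ctg: "continuous_on S g" for S using g(1) by (rule smooth_continuous)
  have cg2: "continuous_on UNIV (\<lambda>t. g t ^ 2)" by (intro continuous_intros ctg)
  obtain h where h: "\<And>t. (h has_vector_derivative g t ^ 2) (at t)"
    using antiderivative_continuous[OF cg2] by auto
  have smh: "smooth h"
    by (rule smooth_derivI[OF h]) (simp add: power2_eq_square smooth_mult g(1))
  have h01: "h 1 - h 0 = 1"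
  proof -
    have "(LBINT t. g t ^ 2) = h 1 - h 0"
      by (rule integral_FTC_supported[OF cg2 _ _ h]) (auto intro!: g(2))
    then show ?thesis using g(3) by simp
  qed
  define e where "e = (\<lambda>(k::int) t. exp ((2 * pi * k * \<i>) * complex_of_real (h t)))"
  define f where "f = (\<lambda>k t. complex_of_real (g t) * e k t)"
  have sme: "smooth (e k)" for k
    unfolding e_def by (intro smooth_exp smooth_mult smooth_const smooth_of_real smh)
  have smf: "smooth (f k)" for k
    unfolding f_def using sme by (intro smooth_mult smooth_of_real g(1)) auto
  have f0: "f k t = 0" if "t \<le> 0 \<or> t \<ge> 1" for k t using g(2)[OF that] by (simp add: f_def)
  have ce: "continuous_on S (e k)" for S k using sme by (rule smooth_continuous)
  have e_cnj: "e k t * cnj (e l t) = e (k - l) t" for k l t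
  proof -
    have "cnj ((2 * pi * l * \<i>) * complex_of_real (h t)) = - ((2 * pi * l * \<i>) * complex_of_real (h t))"
      by simp
    then have "cnj (e l t) = exp (- ((2 * pi * l * \<i>) * complex_of_real (h t)))"
      unfolding e_def exp_cnj by (rule arg_cong)
    then have "e k t * cnj (e l t) = exp ((2 * pi * k * \<i>) * complex_of_real (h t)
        + - ((2 * pi * l * \<i>) * complex_of_real (h t)))"
      unfolding exp_add by (simp add: e_def)
    then show ?thesis by (simp add: e_def left_diff_distrib right_diff_distrib)
  qed
  have ee: "(e k has_vector_derivative (2 * pi * k * \<i>) * (g t)\<^sup>2 * e k t) (at t)" for k t
    unfolding e_def
    by (rule exp_vector_derivative)
      (intro has_vector_derivative_mult_right has_vector_derivative_of_real,
        use h[of t] in \<open>simp flip: of_real_power add: has_real_derivative_iff_has_vector_derivative\<close>)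
  have orth: "(LBINT t. f k t * cnj (f l t)) = of_bool (k = l)" for k l
  proof -
    have eq: "(\<lambda>t. f k t * cnj (f l t)) = (\<lambda>t. (complex_of_real (g t))\<^sup>2 * e (k - l) t)"
      by (auto simp: f_def power2_eq_square simp flip: e_cnj)
    show ?thesis
    proof (cases "k = l")
      case True
      then have "(\<lambda>t. f k t * cnj (f l t)) = (\<lambda>t. complex_of_real ((g t)\<^sup>2))"
        unfolding eq by (simp add: e_def)
      then show ?thesis using g(3) True by (simp del: of_real_power)
    next
      case False
      define w where "w = (2 * pi * (k - l) * \<i>)"
      have w: "w \<noteq> 0" using False by (simp add: w_def)
      have "((\<lambda>t. e (k - l) t / w) has_vector_derivative (complex_of_real (g t))\<^sup>2 * e (k - l) t) (at t)" for t
      proof -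
        have "((\<lambda>t. e (k - l) t / w) has_vector_derivative (w * (g t)\<^sup>2 * e (k - l) t) / w) (at t)"
          unfolding w_def by (rule has_vector_derivative_divide[OF ee[of "k-l" t]])
        moreover have "(w * (g t)\<^sup>2 * e (k - l) t) / w = (complex_of_real (g t))\<^sup>2 * e (k - l) t"
          using w by simp
        ultimately show ?thesis by simp
      qed
      then have "integral\<^sup>L lborel (\<lambda>t. (complex_of_real (g t))\<^sup>2 * e (k - l) t) =
          e (k - l) 1 / w - e (k - l) 0 / w"
        by (intro integral_FTC_supported) (auto intro!: continuous_intros ctg ce simp: g(2))
      also have "e (k - l) 1 = e (k - l) 0"
      proof -
        have "h 1 = h 0 + 1" using h01 by simp
        then have "e (k - l) 1 = e (k - l) 0 * exp (2 * of_int (k - l) * of_real pi * \<i>)"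
          by (simp only: e_def of_real_add of_real_1 distrib_left exp_add) (simp add: mult_ac)
        also have "exp (2 * of_int (k - l) * of_real pi * \<i>) = 1"
          using exp_integer_2pi[of "of_int (k - l)"] by (simp add: mult_ac)
        finally show ?thesis by simp
      qed
      finally show ?thesis using False unfolding eq by simp
    qed
  qed
  \<comment> \<open>In the bracket g' is real and the term with k is imaginary, so the squared
    modulus has no cross term; the cube of g turns into g^6.\<close>
  have D1f: "D1 (f k) t = (D1 g t + \<i> * of_real (2 * pi * k * g t ^ 3)) * e k t" for k t
  proof -
    have "(f k has_vector_derivative of_real (g t) * ((2 * pi * k * \<i>) * (g t)\<^sup>2 * e k t) + of_real (D1 g t) * e k t) (at t)"
      unfolding f_def
      by (intro has_vector_derivative_mult ee has_vector_derivative_of_real)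
         (use smooth_has_deriv[OF g(1)] in \<open>simp add: has_real_derivative_iff_has_vector_derivative\<close>)
    from vector_derivative_at[OF this] show ?thesis
      by (simp add: D1_def algebra_simps power2_eq_square power3_eq_cube)
  qed
  have norme: "norm (e k t) = 1" for k t by (simp add: e_def)
  have nD1f: "(norm (D1 (f k) t))\<^sup>2 = (D1 g t)\<^sup>2 + 4 * pi\<^sup>2 * (of_int k)\<^sup>2 * g t ^ 6" for k t
    unfolding D1f norm_mult norme
    by (simp add: cmod_power2 power_mult_distrib flip: power_mult)
  have "(LBINT t. (norm (D1 (f k) t))\<^sup>2) \<le> (LBINT t. (D1 g t)\<^sup>2) + (1 + \<eta>) * 4 * pi\<^sup>2 * (of_int k)\<^sup>2" for k
  proof -
    have "continuous_on UNIV (D1 g)" using g(1) by (intro smooth_continuous smooth_D1)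
    then have "integrable lborel (\<lambda>t. (D1 g t)\<^sup>2)"
      using D1_eq_0_outside[of 0 1 g] g(2)
      by (intro integrable_continuous_supported[of _ 0 1]) (auto intro!: continuous_intros)
    moreover have "integrable lborel (\<lambda>t. g t ^ 6)"
      using g(2) by (intro integrable_continuous_supported[of _ 0 1]) (auto intro!: continuous_intros ctg)
    ultimately have "(LBINT t. (norm (D1 (f k) t))\<^sup>2) = (LBINT t. (D1 g t)\<^sup>2) + 4 * pi\<^sup>2 * (of_int k)\<^sup>2 * (LBINT t. g t ^ 6)"
      unfolding nD1f by simp
    also have "\<dots> \<le> (LBINT t. (D1 g t)\<^sup>2) + 4 * pi\<^sup>2 * (of_int k)\<^sup>2 * (1 + \<eta>)"
      using g(4) by (intro add_left_mono mult_left_mono) auto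
    also have "4 * pi\<^sup>2 * (of_int k)\<^sup>2 * (1 + \<eta>) = (1 + \<eta>) * 4 * pi\<^sup>2 * (of_int k)\<^sup>2" by simp
    finally show ?thesis .
  qed
  with smf f0 orth have "orbital_family \<eta> (LBINT t. (D1 g t)\<^sup>2) f" by (simp add: orbital_family_def)
  then show ?thesis by blast
qed

subsection \<open>Slater determinants\<close>

lemma
  fixes f :: "'a::euclidean_space \<Rightarrow> real \<Rightarrow> 'b::{real_normed_field,banach,second_countable_topology}"
  assumes int: "\<And>b. b \<in> Basis \<Longrightarrow> integrable lborel (f b)"
  shows integrable_lborel_prod: "integrable lborel (\<lambda>x::'a. \<Prod>b\<in>Basis. f b (x \<bullet> b))"
    and integral_lborel_prod: "integral\<^sup>L lborel (\<lambda>x::'a. \<Prod>b\<in>Basis. f b (x \<bullet> b)) = (\<Prod>b\<in>Basis. integral\<^sup>L lborel (f b))"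
proof -
  interpret product_sigma_finite "\<lambda>_::'a. lborel :: real measure" by standard
  let ?T = "\<lambda>f. \<Sum>b\<in>Basis. f b *\<^sub>R (b::'a)"
  let ?P = "Pi\<^sub>M Basis (\<lambda>_::'a. lborel :: real measure)"
  have T: "?T \<in> measurable ?P borel" by measurable
  have fm: "f b \<in> borel_measurable borel" if "b \<in> Basis" for b
    using borel_measurable_integrable[OF int[OF that]] by simp
  have F: "(\<lambda>x::'a. \<Prod>b\<in>Basis. f b (x \<bullet> b)) \<in> borel_measurable borel"
  proof (rule borel_measurable_prod)
    fix b :: 'a assume "b \<in> Basis"
    have "(\<lambda>x. x \<bullet> b) \<in> borel_measurable borel" by simp
    then show "(\<lambda>x. f b (x \<bullet> b)) \<in> borel_measurable borel"
      using fm[OF \<open>b \<in> Basis\<close>] by (rule measurable_compose)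
  qed
  have eq: "(\<Prod>b\<in>Basis. f b (?T x \<bullet> b)) = (\<Prod>b\<in>Basis. f b (x b))" for x
    by simp
  have "integrable (distr ?P borel ?T) (\<lambda>x::'a. \<Prod>b\<in>Basis. f b (x \<bullet> b))"
    unfolding integrable_distr_eq[OF T F] eq using int by (intro product_integrable_prod) auto
  then show "integrable lborel (\<lambda>x::'a. \<Prod>b\<in>Basis. f b (x \<bullet> b))"
    by (simp flip: lborel_eq)
  have "(\<integral>x. (\<Prod>b\<in>Basis. f b (x \<bullet> b)) \<partial>(distr ?P borel ?T)) = (\<Prod>b\<in>Basis. integral\<^sup>L lborel (f b))"
    unfolding integral_distr[OF T F] eq using int by (intro product_integral_prod) auto
  then show "integral\<^sup>L lborel (\<lambda>x::'a. \<Prod>b\<in>Basis. f b (x \<bullet> b)) = (\<Prod>b\<in>Basis. integral\<^sup>L lborel (f b))"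
    by (simp flip: lborel_eq)
qed

lemma prod_Basis_vec:
  fixes g :: "real^'n \<Rightarrow> 'b::comm_monoid_mult"
  shows "(\<Prod>b\<in>Basis. g b) = (\<Prod>j\<in>UNIV. g (axis j 1))"
proof -
  have B: "(Basis :: (real^'n) set) = (\<lambda>j. axis j 1) ` UNIV" by (auto simp: Basis_vec_def)
  have "inj (\<lambda>j::'n. axis j (1::real))" by (auto simp: inj_def axis_eq_axis)
  then have "prod g ((\<lambda>j. axis j 1) ` UNIV) = (\<Prod>j\<in>UNIV. g (axis j 1))"
    by (subst prod.reindex) auto
  then show ?thesis by (simp only: B)
qed

lemma
  fixes f :: "'n::finite \<Rightarrow> real \<Rightarrow> 'b::{real_normed_field,banach,second_countable_topology}"
  assumes int: "\<And>j. integrable lborel (f j)"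
  shows integrable_lborel_prod_vec: "integrable lborel (\<lambda>x::real^'n. \<Prod>j\<in>UNIV. f j (x $ j))"
    and integral_lborel_prod_vec:
      "integral\<^sup>L lborel (\<lambda>x::real^'n. \<Prod>j\<in>UNIV. f j (x $ j)) = (\<Prod>j\<in>UNIV. integral\<^sup>L lborel (f j))"
proof -
  define F where "F = (\<lambda>b. f (SOME j. b = axis j (1::real)))"
  have F: "F (axis j 1) = f j" for j by (simp add: F_def axis_eq_axis)
  have e: "(\<lambda>x::real^'n. \<Prod>j\<in>UNIV. f j (x $ j)) = (\<lambda>x. \<Prod>b\<in>Basis. F b (x \<bullet> b))"
    by (simp add: prod_Basis_vec F inner_axis)
  have i: "integrable lborel (F b)" for b by (simp add: F_def int)
  show "integrable lborel (\<lambda>x::real^'n. \<Prod>j\<in>UNIV. f j (x $ j))"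
    unfolding e by (rule integrable_lborel_prod[OF i])
  show "integral\<^sup>L lborel (\<lambda>x::real^'n. \<Prod>j\<in>UNIV. f j (x $ j)) = (\<Prod>j\<in>UNIV. integral\<^sup>L lborel (f j))"
    unfolding e integral_lborel_prod[OF i] by (simp add: prod_Basis_vec F)
qed

lemma
  fixes f :: "nat \<Rightarrow> 2 \<Rightarrow> real \<Rightarrow> complex"
  assumes int: "\<And>n j. n < N \<Longrightarrow> integrable lborel (f n j)"
  shows integrable_config_prod: "integrable (config_measure N) (\<lambda>X. \<Prod>n<N. \<Prod>j\<in>UNIV. f n j (X n $ j))"
    and integral_config_prod:
      "(\<integral>X. (\<Prod>n<N. \<Prod>j\<in>UNIV. f n j (X n $ j)) \<partial>config_measure N) = (\<Prod>n<N. \<Prod>j\<in>UNIV. integral\<^sup>L lborel (f n j))"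
proof -
  interpret product_sigma_finite "\<lambda>_::nat. lborel :: (real^2) measure" by standard
  have i: "integrable lborel (\<lambda>x::real^2. \<Prod>j\<in>UNIV. f n j (x $ j))" if "n < N" for n
    using int[OF that] by (rule integrable_lborel_prod_vec)
  show "integrable (config_measure N) (\<lambda>X. \<Prod>n<N. \<Prod>j\<in>UNIV. f n j (X n $ j))"
    unfolding config_measure_def
    using product_integrable_prod[of "{..<N}" "\<lambda>n (x::real^2). \<Prod>j\<in>UNIV. f n j (x $ j)"] i by simp
  show "(\<integral>X. (\<Prod>n<N. \<Prod>j\<in>UNIV. f n j (X n $ j)) \<partial>config_measure N) = (\<Prod>n<N. \<Prod>j\<in>UNIV. integral\<^sup>L lborel (f n j))"
    unfolding config_measure_def
    using product_integral_prod[of "{..<N}" "\<lambda>n (x::real^2). \<Prod>j\<in>UNIV. f n j (x $ j)"] i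
    by (simp add: integral_lborel_prod_vec int)
qed

text \<open>The orbitals may depend on the position \<open>n\<close>, so that derivatives and cut-offs acting on
  single particles are covered.\<close>

definition slater :: "nat \<Rightarrow> (nat \<Rightarrow> nat \<Rightarrow> 2 \<Rightarrow> real \<Rightarrow> complex) \<Rightarrow> config \<Rightarrow> complex" where
  "slater N \<psi> X = (\<Sum>\<sigma> | \<sigma> permutes {..<N}.
     of_int (sign \<sigma>) * (\<Prod>n<N. \<Prod>j\<in>UNIV. \<psi> n (\<sigma> n) j (X n $ j)))"

text \<open>Lets orthogonality fail at one position: two different permutations always differ at a
  further one, where it can still be used.\<close>

lemma permutes_eqI_except_one:
  assumes "\<sigma> permutes S" "\<tau> permutes S" "\<And>n. n \<in> S \<Longrightarrow> n \<noteq> n0 \<Longrightarrow> \<sigma> n = \<tau> n"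
  shows "\<sigma> = \<tau>"
proof -
  have *: "\<sigma> n = \<tau> n" if "n \<noteq> n0" for n
    using that assms by (cases "n \<in> S") (auto simp: permutes_not_in)
  have "\<sigma> n0 = \<tau> n0"
  proof (rule ccontr)
    assume ne: "\<sigma> n0 \<noteq> \<tau> n0"
    obtain m where m: "\<tau> m = \<sigma> n0" using permutes_surj[OF assms(2)] by (metis surj_def)
    then have "m \<noteq> n0" using ne by auto
    then have "\<sigma> m = \<sigma> n0" using * m by simp
    then show False using injD[OF permutes_inj[OF assms(1)]] \<open>m \<noteq> n0\<close> by blast
  qed
  then have "\<sigma> n = \<tau> n" for n using *[of n] by (cases "n = n0") simp_all
  then show ?thesis by (rule ext)
qed

text \<open>Expanding the square gives pairs of permutations, and Fubini turns each pair into a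
  product of one-dimensional overlaps. Two different permutations differ at some position other than
  \<open>n0\<close>, and one vanishing overlap there kills the product. The exception
  \<open>n0\<close> is meant for the position of a differentiated orbital; \<open>n0 = N\<close>
  means no exception.\<close>

lemma slater_norm_integral:
  assumes int: "\<And>n i i' j. n < N \<Longrightarrow> integrable lborel (\<lambda>t. \<psi> n i j t * cnj (\<psi> n i' j t))"
    and orth: "\<And>n i i'. n < N \<Longrightarrow> n \<noteq> n0 \<Longrightarrow> i < N \<Longrightarrow> i' < N \<Longrightarrow> i \<noteq> i' \<Longrightarrow>
      \<exists>j. (LBINT t. \<psi> n i j t * cnj (\<psi> n i' j t)) = 0"
  shows "(\<integral>\<^sup>+X. ennreal ((norm (slater N \<psi> X))\<^sup>2) \<partial>config_measure N) =
    ennreal (\<Sum>\<sigma> | \<sigma> permutes {..<N}. \<Prod>n<N. \<Prod>j\<in>UNIV. (LBINT t. (norm (\<psi> n (\<sigma> n) j t))\<^sup>2))"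
proof -
  let ?S = "{\<sigma>. \<sigma> permutes {..<N}}"
  define I where "I = (\<lambda>n i i' j. LBINT t. \<psi> n i j t * cnj (\<psi> n i' j t))"
  define p where "p = (\<lambda>\<sigma> \<tau> X. \<Prod>n<N. \<Prod>j\<in>UNIV. \<psi> n (\<sigma> n) j (X n $ j) * cnj (\<psi> n (\<tau> n) j (X n $ j)))"
  have fin: "finite ?S" by (simp add: finite_permutations)
  have sq: "complex_of_real ((norm (slater N \<psi> X))\<^sup>2) =
     (\<Sum>\<sigma>\<in>?S. \<Sum>\<tau>\<in>?S. of_int (sign \<sigma>) * of_int (sign \<tau>) * p \<sigma> \<tau> X)" for X
    unfolding complex_norm_square slater_def cnj_sum sum_product
    by (intro sum.cong refl) (simp add: p_def prod.distrib)
  have pint: "integrable (config_measure N) (p \<sigma> \<tau>)" for \<sigma> \<tau>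
    unfolding p_def using int by (rule integrable_config_prod)
  have pI: "(\<integral>X. p \<sigma> \<tau> X \<partial>config_measure N) = (\<Prod>n<N. \<Prod>j\<in>UNIV. I n (\<sigma> n) (\<tau> n) j)" for \<sigma> \<tau>
    unfolding p_def I_def using int by (rule integral_config_prod)
  have pI0: "(\<Prod>n<N. \<Prod>j\<in>UNIV. I n (\<sigma> n) (\<tau> n) j) = 0" if st: "\<sigma> \<in> ?S" "\<tau> \<in> ?S" "\<sigma> \<noteq> \<tau>" for \<sigma> \<tau>
  proof -
    obtain n where n: "n < N" "n \<noteq> n0" "\<sigma> n \<noteq> \<tau> n"
      using permutes_eqI_except_one[of \<sigma> "{..<N}" \<tau> n0] st by blast
    moreover have "\<sigma> n < N" "\<tau> n < N" using st n permutes_in_image[of \<sigma> "{..<N}" n] permutes_in_image[of \<tau> "{..<N}" n] by simp_all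
    ultimately obtain j where "I n (\<sigma> n) (\<tau> n) j = 0" using orth unfolding I_def by blast
    then have "(\<Prod>j\<in>UNIV. I n (\<sigma> n) (\<tau> n) j) = 0" by (intro prod_zero) auto
    then show ?thesis using n by (intro prod_zero) auto
  qed
  have Id: "I n i i j = complex_of_real (LBINT t. (norm (\<psi> n i j t))\<^sup>2)" for n i j
    unfolding I_def complex_norm_square[symmetric] by (rule integral_complex_of_real)
  have intc: "integrable (config_measure N) (\<lambda>X. complex_of_real ((norm (slater N \<psi> X))\<^sup>2))"
    unfolding sq by (intro Bochner_Integration.integrable_sum integrable_mult_right pint)
  then have intr: "integrable (config_measure N) (\<lambda>X. (norm (slater N \<psi> X))\<^sup>2)"
    by (simp only: complex_of_real_integrable_eq)
  have "complex_of_real (\<integral>X. (norm (slater N \<psi> X))\<^sup>2 \<partial>config_measure N) =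
      (\<integral>X. complex_of_real ((norm (slater N \<psi> X))\<^sup>2) \<partial>config_measure N)"
    by (rule integral_complex_of_real[symmetric])
  also have "\<dots> = (\<Sum>\<sigma>\<in>?S. \<Sum>\<tau>\<in>?S. of_int (sign \<sigma>) * of_int (sign \<tau>) *
      (\<Prod>n<N. \<Prod>j\<in>UNIV. I n (\<sigma> n) (\<tau> n) j))"
    unfolding sq
    by (subst Bochner_Integration.integral_sum, (intro Bochner_Integration.integrable_sum integrable_mult_right pint),
        subst Bochner_Integration.integral_sum, (intro integrable_mult_right pint))
       (simp add: pI)
  also have "\<dots> = (\<Sum>\<sigma>\<in>?S. \<Sum>\<tau>\<in>?S. if \<tau> = \<sigma> then (\<Prod>n<N. \<Prod>j\<in>UNIV. I n (\<sigma> n) (\<sigma> n) j) else 0)"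
    by (intro sum.cong refl) (auto simp: pI0 sign_def)
  also have "\<dots> = (\<Sum>\<sigma>\<in>?S. (\<Prod>n<N. \<Prod>j\<in>UNIV. I n (\<sigma> n) (\<sigma> n) j))"
    using fin by (simp add: sum.delta)
  also have "\<dots> = complex_of_real (\<Sum>\<sigma>\<in>?S. \<Prod>n<N. \<Prod>j\<in>UNIV. (LBINT t. (norm (\<psi> n (\<sigma> n) j t))\<^sup>2))"
    by (simp add: Id)
  finally have "(\<integral>X. (norm (slater N \<psi> X))\<^sup>2 \<partial>config_measure N) =
     (\<Sum>\<sigma>\<in>?S. \<Prod>n<N. \<Prod>j\<in>UNIV. (LBINT t. (norm (\<psi> n (\<sigma> n) j t))\<^sup>2))"
    by (simp only: of_real_eq_iff)
  then show ?thesis using nn_integral_eq_integral[OF intr] by simp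
qed

section \<open>Derivatives and regularity of determinants\<close>

lemma smooth_iter_D1: "smooth f \<Longrightarrow> smooth ((D1 ^^ k) f)"
  by (induction k) (auto intro: smooth_D1)

lemma prod_split_coordinate:
  fixes f :: "nat \<Rightarrow> 2 \<Rightarrow> 'a::comm_monoid_mult"
  assumes "n < N"
  shows "(\<Prod>m<N. \<Prod>l\<in>UNIV. f m l) = f n j * (\<Prod>(m, l)\<in>({..<N} \<times> UNIV) - {(n, j)}. f m l)"
proof -
  have "(\<Prod>m<N. \<Prod>l\<in>UNIV. f m l) = (\<Prod>(m, l)\<in>{..<N} \<times> UNIV. f m l)"
    by (rule prod.cartesian_product)
  also have "\<dots> = f n j * (\<Prod>(m, l)\<in>({..<N} \<times> UNIV) - {(n, j)}. f m l)"
    using assms by (subst prod.remove[of _ "(n, j)"]) auto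
  finally show ?thesis .
qed

text \<open>\<open>\<alpha> n j\<close> counts the derivatives taken in coordinate \<open>j\<close>
  of particle \<open>n\<close>. A partial derivative raises one entry, so all iterated partials stay
  in this family, and smoothness reduces to continuity and a single differentiation rule.\<close>

definition slater_deriv :: "nat \<Rightarrow> (nat \<Rightarrow> 2 \<Rightarrow> real \<Rightarrow> complex) \<Rightarrow> (nat \<Rightarrow> 2 \<Rightarrow> nat) \<Rightarrow> config \<Rightarrow> complex" where
  "slater_deriv N F \<alpha> = slater N (\<lambda>n i j. (D1 ^^ \<alpha> n j) (F i j))"

definition incr :: "nat \<times> 2 \<Rightarrow> (nat \<Rightarrow> 2 \<Rightarrow> nat) \<Rightarrow> nat \<Rightarrow> 2 \<Rightarrow> nat" where
  "incr p \<alpha> = (\<lambda>m l. if (m, l) = p then Suc (\<alpha> m l) else \<alpha> m l)"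

text \<open>Each term of the determinant is a product in which just one factor depends on the
  shifted coordinate.\<close>

lemma slater_deriv_has_deriv:
  assumes F: "\<And>i j. smooth (F i j)" and n: "n < N"
  shows "((\<lambda>t. slater_deriv N F \<alpha> (shift n j t X)) has_vector_derivative
     slater_deriv N F (incr (n, j) \<alpha>) X) (at 0)"
proof -
  have 1: "shift n j t X m $ l = X m $ l + (if (m, l) = (n, j) then t else 0)" for t m l
    by (auto simp: shift_def axis_def)
  have trm: "((\<lambda>t. \<Prod>m<N. \<Prod>l\<in>UNIV. (D1 ^^ \<alpha> m l) (F (\<sigma> m) l) (shift n j t X m $ l)) has_vector_derivative
      (\<Prod>m<N. \<Prod>l\<in>UNIV. (D1 ^^ incr (n, j) \<alpha> m l) (F (\<sigma> m) l) (X m $ l))) (at 0)" for \<sigma>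
  proof -
    let ?R = "\<Prod>(m, l)\<in>({..<N} \<times> UNIV) - {(n, j)}. (D1 ^^ \<alpha> m l) (F (\<sigma> m) l) (X m $ l)"
    let ?f = "(D1 ^^ \<alpha> n j) (F (\<sigma> n) j)"
    have a: "(\<Prod>m<N. \<Prod>l\<in>UNIV. (D1 ^^ \<alpha> m l) (F (\<sigma> m) l) (shift n j t X m $ l)) = ?f (t + X n $ j) * ?R" for t
      unfolding prod_split_coordinate[OF n, of _ j] 1
      by (intro arg_cong2[where f="(*)"] prod.cong) (auto simp: add.commute split: if_splits)
    have b: "(\<Prod>m<N. \<Prod>l\<in>UNIV. (D1 ^^ incr (n, j) \<alpha> m l) (F (\<sigma> m) l) (X m $ l)) = D1 ?f (X n $ j) * ?R"
      unfolding prod_split_coordinate[OF n, of _ j]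
      by (intro arg_cong2[where f="(*)"] prod.cong) (auto simp: incr_def split: if_splits)
    have "(?f has_vector_derivative D1 ?f (0 + X n $ j)) (at (0 + X n $ j))"
      by (intro smooth_has_deriv smooth_iter_D1 F)
    moreover have "((\<lambda>t. t + X n $ j) has_vector_derivative 1) (at 0)"
      by (auto intro!: derivative_eq_intros)
    ultimately have "((\<lambda>t. ?f (t + X n $ j)) has_vector_derivative D1 ?f (X n $ j)) (at 0)"
      using vector_diff_chain_at[of "\<lambda>t. t + X n $ j" 1 0 ?f "D1 ?f (X n $ j)"] by (simp add: o_def)
    then show ?thesis unfolding a b by (rule has_vector_derivative_mult_left)
  qed
  show ?thesis unfolding slater_deriv_def slater_def
    by (intro has_vector_derivative_sum has_vector_derivative_mult_right trm)
qed

lemma partial_deriv_slater_deriv: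
  assumes "\<And>i j. smooth (F i j)" and "n < N"
  shows "partial_deriv (n, j) (slater_deriv N F \<alpha>) = slater_deriv N F (incr (n, j) \<alpha>)"
  using vector_derivative_at[OF slater_deriv_has_deriv[where F=F, OF assms]]
  by (auto simp: partial_deriv_def)

lemma iter_partial_slater_deriv:
  assumes "\<And>i j. smooth (F i j)" and "set ds \<subseteq> {..<N} \<times> UNIV"
  shows "\<exists>\<alpha>. iter_partial ds (slater_deriv N F \<beta>) = slater_deriv N F \<alpha>"
  using assms(2)
proof (induction ds)
  case Nil then show ?case by (auto simp: iter_partial_def)
next
  case (Cons d ds)
  obtain n j where d: "d = (n, j)" by (cases d)
  from Cons obtain \<alpha> where "iter_partial ds (slater_deriv N F \<beta>) = slater_deriv N F \<alpha>" by auto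
  then have "iter_partial (d # ds) (slater_deriv N F \<beta>) = slater_deriv N F (incr d \<alpha>)"
    using partial_deriv_slater_deriv[where F=F and n=n and N=N] assms(1) Cons.prems d by (simp add: iter_partial_def)
  then show ?case by blast
qed

lemma continuous_slater:
  assumes "\<And>n i j. continuous_on UNIV (\<psi> n i j)"
  shows "continuous_on S (slater N \<psi>)"
proof -
  have "continuous_on S (\<lambda>X::config. \<psi> n i j (X n $ j))" for n i j
  proof (rule continuous_on_compose2[OF assms])
    have "continuous_on S (\<lambda>X::config. X n)"
      using continuous_on_product_coordinates by (rule continuous_on_subset) simp
    then show "continuous_on S (\<lambda>X::config. X n $ j)" by (rule continuous_on_component)
  qed auto
  then show ?thesis unfolding slater_def by (intro continuous_intros)
qed

lemma borel_measurable_config_component: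
  assumes "f \<in> borel_measurable borel" "n < N"
  shows "(\<lambda>X. f (X n $ j)) \<in> borel_measurable (config_measure N)"
proof -
  have "(\<lambda>X. X n) \<in> measurable (config_measure N) lborel"
    unfolding config_measure_def by (rule measurable_component_singleton) (use assms in auto)
  moreover have "(\<lambda>x::real^2. x $ j) \<in> borel_measurable lborel"
    by (simp add: borel_measurable_continuous_onI continuous_on_component)
  ultimately have "(\<lambda>X. X n $ j) \<in> borel_measurable (config_measure N)"
    by (rule measurable_compose)
  then show ?thesis using assms(1) by (rule measurable_compose)
qed

lemma borel_measurable_slater:
  assumes "\<And>n i j. \<psi> n i j \<in> borel_measurable borel"
  shows "slater N \<psi> \<in> borel_measurable (config_measure N)"
  unfolding slater_def using assms
  by (intro borel_measurable_sum borel_measurable_times borel_measurable_prod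
      borel_measurable_const borel_measurable_config_component) auto

text \<open>Extensional functions have the fixed value \<open>undefined\<close> from
  \<open>N\<close> on, so the box is a product of compact sets over all natural numbers and
  Tychonoff applies.\<close>

lemma compact_config_box: "compact (PiE {..<N} (\<lambda>_. cbox a b) :: config set)"
proof -
  have eq: "(PiE {..<N} (\<lambda>_. cbox a b) :: config set) =
      PiE UNIV (\<lambda>n. if n < N then cbox a b else {undefined})"
    by (auto simp: PiE_def Pi_def extensional_def split: if_splits)
  have "compactin (product_topology (\<lambda>_. euclidean) UNIV)
      (PiE UNIV (\<lambda>n. if n < N then cbox a b else {undefined}) :: config set)"
    by (subst compactin_PiE) auto
  then show ?thesis unfolding eq by (simp add: euclidean_product_topology)
qed

text \<open>Outside the box some coordinate of some particle exceeds \<open>R\<close> in modulus.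
  Permutations preserve the index range, so in every term the orbital at that position has an index
  below \<open>N\<close> and vanishes there.\<close>

lemma test_function_slater_deriv:
  assumes F: "\<And>i j. smooth (F i j)"
    and supp: "\<And>i j t. i < N \<Longrightarrow> \<bar>t\<bar> > R \<Longrightarrow> F i j t = 0"
  shows "test_function N (slater_deriv N F (\<lambda>_ _. 0))"
  unfolding test_function_def
proof
  show "smooth_config N (slater_deriv N F (\<lambda>_ _. 0))"
    unfolding smooth_config_def
  proof (intro allI impI conjI ballI)
    fix ds :: "(nat \<times> 2) list" assume ds: "set ds \<subseteq> {..<N} \<times> UNIV"
    obtain \<alpha> where \<alpha>: "iter_partial ds (slater_deriv N F (\<lambda>_ _. 0)) = slater_deriv N F \<alpha>"
      using iter_partial_slater_deriv[where F=F, OF F ds] by blast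
    show "continuous_on (config_space N) (iter_partial ds (slater_deriv N F (\<lambda>_ _. 0)))"
      unfolding \<alpha> unfolding slater_deriv_def
      by (intro continuous_slater smooth_continuous smooth_iter_D1 F)
    fix X n j assume "n < N"
    then show "(\<lambda>t. iter_partial ds (slater_deriv N F (\<lambda>_ _. 0)) (shift n j t X)) differentiable (at 0)"
      unfolding \<alpha> using slater_deriv_has_deriv[where F=F and n=n and N=N, OF F] by (blast intro: differentiableI_vector)
  qed
  let ?K = "PiE {..<N} (\<lambda>_. cbox (\<chi> j. - R) (\<chi> j. R)) :: config set"
  have "slater_deriv N F (\<lambda>_ _. 0) X = 0" if X: "X \<in> config_space N - ?K" for X
  proof -
    obtain n where n: "n < N" "X n \<notin> cbox (\<chi> j. - R) (\<chi> j. R)"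
      using X by (auto simp: config_space_def PiE_def Pi_def)
    then obtain j where "\<not> (- R \<le> X n $ j \<and> X n $ j \<le> R)" by (auto simp: mem_box_cart)
    then have j: "\<bar>X n $ j\<bar> > R" by linarith
    have "(\<Prod>m<N. \<Prod>l\<in>UNIV. F (\<sigma> m) l (X m $ l)) = 0" if "\<sigma> permutes {..<N}" for \<sigma>
    proof -
      have "\<sigma> n < N" using permutes_in_image[OF that, of n] n by simp
      then have "F (\<sigma> n) j (X n $ j) = 0" using supp j by blast
      then have "(\<Prod>l\<in>UNIV. F (\<sigma> n) l (X n $ l)) = 0" by (intro prod_zero) auto
      then show ?thesis using n by (intro prod_zero) auto
    qed
    then show ?thesis unfolding slater_deriv_def slater_def by (intro sum.neutral) auto
  qed
  moreover have "compact ?K" by (rule compact_config_box)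
  moreover have "?K \<subseteq> config_space N" by (auto simp: config_space_def)
  ultimately show "\<exists>K. compact K \<and> K \<subseteq> config_space N \<and>
      (\<forall>X\<in>config_space N - K. slater_deriv N F (\<lambda>_ _. 0) X = 0)" by blast
qed

text \<open>With orbitals independent of the position, permuting the particles is undone by
  reindexing each product with \<open>inv \<rho>\<close> and the sum with
  \<open>\<sigma> \<circ> \<rho>\<close>, which costs the sign.\<close>

lemma antisymmetric_slater: "antisymmetric N (slater N (\<lambda>n. F))"
  unfolding antisymmetric_def
proof (intro allI impI AE_I2)
  fix \<rho> :: "nat \<Rightarrow> nat" and X assume \<rho>: "\<rho> permutes {..<N}"
  let ?S = "{\<sigma>. \<sigma> permutes {..<N}}"
  define P where "P = (\<lambda>\<sigma> X. \<Prod>n<N. \<Prod>j\<in>UNIV. F (\<sigma> n) j (X n $ j))"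
  have "P \<sigma> (X \<circ> \<rho>) = P (\<sigma> \<circ> inv \<rho>) X" for \<sigma>
  proof -
    have "P (\<sigma> \<circ> inv \<rho>) X = (\<Prod>n<N. \<Prod>j\<in>UNIV. F (\<sigma> (inv \<rho> (\<rho> n))) j (X (\<rho> n) $ j))"
      unfolding P_def o_def
      by (rule prod.reindex_bij_betw[OF permutes_imp_bij[OF \<rho>], symmetric])
    then show ?thesis using permutes_inverses(2)[OF \<rho>] by (simp add: P_def)
  qed
  then have "slater N (\<lambda>n. F) (X \<circ> \<rho>) = (\<Sum>\<sigma>\<in>?S. of_int (sign \<sigma>) * P (\<sigma> \<circ> inv \<rho>) X)"
    by (simp add: slater_def P_def)
  also have "\<dots> = (\<Sum>\<sigma>\<in>?S. of_int (sign (\<sigma> \<circ> \<rho>)) * P ((\<sigma> \<circ> \<rho>) \<circ> inv \<rho>) X)"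
    by (rule sum_permutations_compose_right[OF \<rho>])
  also have "\<dots> = (\<Sum>\<sigma>\<in>?S. of_int (sign \<rho>) * (of_int (sign \<sigma>) * P \<sigma> X))"
  proof (intro sum.cong refl)
    fix \<sigma> assume "\<sigma> \<in> ?S"
    then have "sign (\<sigma> \<circ> \<rho>) = sign \<sigma> * sign \<rho>"
      using \<rho> by (intro sign_compose) (auto intro: permutation_permutes[THEN iffD2])
    moreover have "(\<sigma> \<circ> \<rho>) \<circ> inv \<rho> = \<sigma>" using permutes_inv_o(1)[OF \<rho>] by (simp add: o_assoc[symmetric])
    ultimately show "of_int (sign (\<sigma> \<circ> \<rho>)) * P ((\<sigma> \<circ> \<rho>) \<circ> inv \<rho>) X =
        of_int (sign \<rho>) * (of_int (sign \<sigma>) * P \<sigma> X)" by simp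
  qed
  also have "\<dots> = of_int (sign \<rho>) * slater N (\<lambda>n. F) X"
    by (simp add: slater_def P_def sum_distrib_left)
  finally show "slater N (\<lambda>n. F) X = of_int (sign \<rho>) * slater N (\<lambda>n. F) (X \<circ> \<rho>)"
    by (auto simp: sign_def split: if_splits)
qed

subsection \<open>Orbitals in disjoint cells\<close>

lemma D1_translate:
  assumes "smooth f"
  shows "D1 (\<lambda>t. f (t + c)) = (\<lambda>t. D1 f (t + c))"
proof
  fix t
  have "((\<lambda>t. t + c) has_vector_derivative 1) (at t)"
    by (auto intro!: derivative_eq_intros)
  from vector_diff_chain_at[OF this, of f "D1 f (t + c)"] smooth_has_deriv[OF assms, of "t + c"]
  have "((\<lambda>t. f (t + c)) has_vector_derivative D1 f (t + c)) (at t)" by (simp add: o_def)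
  then show "D1 (\<lambda>t. f (t + c)) t = D1 f (t + c)" by (simp add: D1_def vector_derivative_at)
qed

lemma lborel_integral_translate:
  fixes f :: "real \<Rightarrow> 'a :: {banach, second_countable_topology}"
  shows "(LBINT t. f (t + c)) = integral\<^sup>L lborel f"
  using lborel_integral_real_affine[of 1 f c] by (simp add: add.commute)

lemma sum_permuted:
  assumes "\<sigma> permutes {..<N}"
  shows "(\<Sum>n<N. g (\<sigma> n)) = (\<Sum>n<N. g n)"
  by (rule sum.reindex_bij_betw[OF permutes_imp_bij[OF assms]])

text \<open>The Hardy term runs over n < m, a range that relabelling the particles does not
  preserve; the full double sum is invariant.\<close>

lemma sum_less_pairs_symmetric:
  fixes g :: "nat \<Rightarrow> nat \<Rightarrow> real"
  assumes "\<And>n m. g n m = g m n" "\<And>n. g n n = 0"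
  shows "(\<Sum>(n, m)\<in>{(n, m). n < m \<and> m < N}. g n m) = (\<Sum>n<N. \<Sum>m<N. g n m) / 2"
proof -
  let ?U = "{(n, m). n < m \<and> m < N}" and ?L = "{(n, m). m < n \<and> n < N}" and ?D = "(\<lambda>n. (n, n)) ` {..<N}"
  have fin: "finite ?U" "finite ?L" "finite ?D"
    by (auto intro: finite_subset[of _ "{..<N} \<times> {..<N}"])
  have "(\<Sum>n<N. \<Sum>m<N. g n m) = (\<Sum>(n, m)\<in>{..<N} \<times> {..<N}. g n m)"
    by (rule sum.cartesian_product)
  also have "{..<N} \<times> {..<N} = (?U \<union> ?L) \<union> ?D" by auto
  also have "(\<Sum>(n, m)\<in>(?U \<union> ?L) \<union> ?D. g n m) =
      (\<Sum>(n, m)\<in>?U. g n m) + (\<Sum>(n, m)\<in>?L. g n m) + (\<Sum>(n, m)\<in>?D. g n m)"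
    using fin by (subst sum.union_disjoint, auto)+
  also have "(\<Sum>(n, m)\<in>?L. g n m) = (\<Sum>(n, m)\<in>?U. g n m)"
    by (rule sum.reindex_bij_witness[of _ "\<lambda>(n, m). (m, n)" "\<lambda>(n, m). (m, n)"]) (auto simp: assms(1))
  also have "(\<Sum>(n, m)\<in>?D. g n m) = 0" by (intro sum.neutral) (auto simp: assms(2))
  finally show ?thesis by simp
qed

section \<open>Unit cells and weights of pairs of cells\<close>

definition real_vec :: "int^2 \<Rightarrow> real^2" where
  "real_vec v = (\<chi> j. of_int (v $ j))"

definition cell :: "real^2 \<Rightarrow> int^2" where
  "cell x = (\<chi> j. \<lfloor>x $ j\<rfloor>)"

text \<open>The 2 bounds, through the l1 norm, how far the difference of two points deviates from
  that of their cells; it changes the lattice sums of inverse squares by a bounded amount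
  only.\<close>

definition cell_dist :: "int^2 \<Rightarrow> int^2 \<Rightarrow> real" where
  "cell_dist b c = norm (real_vec (b - c)) + 2"

lemma cell_dist_ge: "cell_dist b c \<ge> 2" by (simp add: cell_dist_def)

lemma norm_le_2:
  fixes z :: "real^2" assumes "\<And>j. \<bar>z $ j\<bar> \<le> 1" shows "norm z \<le> 2"
proof -
  have "(\<Sum>j\<in>UNIV. \<bar>z $ j\<bar>) \<le> (\<Sum>j\<in>(UNIV::2 set). 1)" using assms by (intro sum_mono) blast
  then show ?thesis using norm_le_l1_cart[of z] by simp
qed

lemma norm_diff_le_cell_dist: "norm (x - y) \<le> cell_dist (cell x) (cell y)"
proof -
  let ?z = "x - y - real_vec (cell x - cell y)"
  have "\<bar>?z $ j\<bar> \<le> 1" for j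
    unfolding real_vec_def cell_def by simp linarith
  then have "norm ?z \<le> 2" by (rule norm_le_2)
  moreover have "norm (x - y) \<le> norm ?z + norm (real_vec (cell x - cell y))"
    using norm_triangle_ineq[of ?z "real_vec (cell x - cell y)"] by simp
  ultimately show ?thesis by (simp add: cell_dist_def)
qed

lemma cell_dist_commute: "cell_dist b c = cell_dist c b"
proof -
  have "real_vec (b - c) = - real_vec (c - b)" by (simp add: real_vec_def vec_eq_iff)
  then show ?thesis by (simp add: cell_dist_def)
qed

text \<open>The diagonal value has to be 0: for coinciding particles the Hardy quotient is 0 by the
  convention for division by zero, and the double sum in \<open>H\<close> includes
  \<open>i = i'\<close>.\<close>

definition pair_weight :: "int^2 \<Rightarrow> int^2 \<Rightarrow> real" where
  "pair_weight b c = (if b = c then 0 else 1 / (cell_dist b c)\<^sup>2)"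

lemma pair_weight_nonneg: "pair_weight b c \<ge> 0" by (simp add: pair_weight_def)

lemma pair_weight_le:
  assumes "a \<ge> 0"
  shows "pair_weight (cell x) (cell y) * a \<le> a / (norm (x - y))\<^sup>2"
proof (cases "cell x = cell y")
  case False
  then have "norm (x - y) > 0" by auto
  moreover have "1 / (cell_dist (cell x) (cell y))\<^sup>2 \<le> 1 / (norm (x - y))\<^sup>2"
    using \<open>norm (x - y) > 0\<close> norm_diff_le_cell_dist[of x y] cell_dist_ge[of "cell x" "cell y"]
    by (intro divide_left_mono power_mono mult_pos_pos) auto
  ultimately show ?thesis using False mult_right_mono[OF _ assms] by (fastforce simp: pair_weight_def)
qed (use assms in \<open>simp add: pair_weight_def\<close>)

text \<open>Orbital \<open>i\<close> lives in the cell \<open>p i\<close> with momentum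
  \<open>\<kappa> i\<close>, one component per direction, and is a product of two translated members
  of \<open>f\<close>. The assumption \<open>inj\<close> is the Pauli principle: no momentum occurs
  twice in one cell.\<close>

locale cell_orbitals =
  fixes f :: "int \<Rightarrow> real \<Rightarrow> complex" and e :: "int \<Rightarrow> real"
    and N :: nat and p \<kappa> :: "nat \<Rightarrow> int^2"
  assumes f_smooth: "\<And>k. smooth (f k)"
    and f_supp: "\<And>k t. t \<le> 0 \<or> t \<ge> 1 \<Longrightarrow> f k t = 0"
    and f_orth: "\<And>k l. (LBINT t. f k t * cnj (f l t)) = of_bool (k = l)"
    and f_energy: "\<And>k. (LBINT t. (norm (D1 (f k) t))\<^sup>2) \<le> e k"
    and inj: "\<And>i i'. i < N \<Longrightarrow> i' < N \<Longrightarrow> p i = p i' \<Longrightarrow> \<kappa> i = \<kappa> i' \<Longrightarrow> i = i'"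
begin

definition F :: "nat \<Rightarrow> 2 \<Rightarrow> real \<Rightarrow> complex" where
  "F i j t = f (\<kappa> i $ j) (t + - of_int (p i $ j))"

definition u :: "config \<Rightarrow> complex" where "u = slater_deriv N F (\<lambda>_ _. 0)"

lemma u_eq: "u = slater N (\<lambda>n. F)" by (simp add: u_def slater_deriv_def)

lemma F_smooth: "smooth (F i j)"
proof -
  have "smooth (\<lambda>t. f (\<kappa> i $ j) (1 * t + - of_int (p i $ j)))"
    by (intro smooth_affine f_smooth)
  moreover have "F i j = (\<lambda>t. f (\<kappa> i $ j) (1 * t + - of_int (p i $ j)))" by (simp add: F_def fun_eq_iff)
  ultimately show ?thesis by simp
qed

lemma F_nonzero: "F i j t \<noteq> 0 \<Longrightarrow> \<lfloor>t\<rfloor> = p i $ j"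
proof -
  assume "F i j t \<noteq> 0"
  then have "\<not> (t + - of_int (p i $ j) \<le> 0 \<or> t + - of_int (p i $ j) \<ge> 1)"
    using f_supp unfolding F_def by blast
  then show ?thesis by linarith
qed

text \<open>Either reason for orthogonality shows in a single coordinate: disjoint supports if the
  cells differ there, orthogonality of the family if only the momenta do.\<close>

lemma F_orth: "(LBINT t. F i j t * cnj (F i' j t)) = of_bool (p i $ j = p i' $ j \<and> \<kappa> i $ j = \<kappa> i' $ j)"
proof (cases "p i $ j = p i' $ j")
  case True
  have "(LBINT t. F i j t * cnj (F i' j t)) = (LBINT t. f (\<kappa> i $ j) t * cnj (f (\<kappa> i' $ j) t))"
    unfolding F_def True
    by (rule lborel_integral_translate[of "\<lambda>t. f (\<kappa> i $ j) t * cnj (f (\<kappa> i' $ j) t)"])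
  then show ?thesis using True by (simp add: f_orth)
next
  case False
  then have "F i j t * cnj (F i' j t) = 0" for t using F_nonzero[of i j t] F_nonzero[of i' j t] by force
  then have "(\<lambda>t. F i j t * cnj (F i' j t)) = (\<lambda>_. 0)" by (rule ext)
  then have "(LBINT t. F i j t * cnj (F i' j t)) = (LBINT t::real. 0)" by (rule arg_cong)
  then show ?thesis using False by simp
qed

lemma F_norm: "(LBINT t. (norm (F i j t))\<^sup>2) = 1"
proof -
  have "complex_of_real (LBINT t. (norm (F i j t))\<^sup>2) = (LBINT t. F i j t * cnj (F i j t))"
    unfolding complex_norm_square[symmetric] by (rule integral_complex_of_real[symmetric])
  also have "\<dots> = complex_of_real 1" unfolding F_orth by simp
  finally show ?thesis by (simp only: of_real_eq_iff)
qed

lemma F_energy: "(LBINT t. (norm (D1 (F i j) t))\<^sup>2) \<le> e (\<kappa> i $ j)"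
proof -
  have "D1 (F i j) = (\<lambda>t. D1 (f (\<kappa> i $ j)) (t + - of_int (p i $ j)))"
    unfolding F_def by (rule D1_translate[OF f_smooth])
  then show ?thesis
    using f_energy[of "\<kappa> i $ j"]
      lborel_integral_translate[of "\<lambda>t. (norm (D1 (f (\<kappa> i $ j)) t))\<^sup>2" "- of_int (p i $ j)"] by simp
qed

lemma F_vanishes: "t < of_int (p i $ j) \<or> t > of_int (p i $ j) + 1 \<Longrightarrow> F i j t = 0"
  using F_nonzero[of i j t] by linarith

lemma F_integrable: "integrable lborel (\<lambda>t. F i j t * cnj (F i' j t))"
proof (rule integrable_continuous_supported[of _ "of_int (p i $ j)" "of_int (p i $ j) + 1"])
  show "continuous_on UNIV (\<lambda>t. F i j t * cnj (F i' j t))"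
    by (intro continuous_on_mult continuous_on_cnj smooth_continuous[OF F_smooth])
qed (use F_vanishes in auto)

lemma D1_F_integrable: "integrable lborel (\<lambda>t. D1 (F i j) t * cnj (D1 (F i' j) t))"
proof (rule integrable_continuous_supported[of _ "of_int (p i $ j)" "of_int (p i $ j) + 1"])
  show "continuous_on UNIV (\<lambda>t. D1 (F i j) t * cnj (D1 (F i' j) t))"
    by (intro continuous_on_mult continuous_on_cnj smooth_continuous[OF smooth_D1[OF F_smooth]])
  fix t assume t: "t < real_of_int (p i $ j) \<or> t > real_of_int (p i $ j) + 1"
  have "F i j s = 0" if "s \<le> real_of_int (p i $ j) \<or> s \<ge> real_of_int (p i $ j) + 1" for s
    unfolding F_def using that by (intro f_supp) linarith
  then show "D1 (F i j) t * cnj (D1 (F i' j) t) = 0"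
    using D1_eq_0_outside[of "real_of_int (p i $ j)" "real_of_int (p i $ j) + 1" "F i j" t] t by simp
qed

lemma F_orth_ex:
  assumes "i < N" "i' < N" "i \<noteq> i'"
  shows "\<exists>j. (LBINT t. F i j t * cnj (F i' j t)) = 0"
proof -
  have "\<not> (p i = p i' \<and> \<kappa> i = \<kappa> i')" using inj assms by blast
  then obtain j where "\<not> (p i $ j = p i' $ j \<and> \<kappa> i $ j = \<kappa> i' $ j)" by (auto simp: vec_eq_iff)
  then show ?thesis unfolding F_orth by auto
qed

lemma norm_u: "(\<integral>\<^sup>+X. ennreal ((norm (u X))\<^sup>2) \<partial>config_measure N) = ennreal (fact N)"
proof -
  have "(\<integral>\<^sup>+X. ennreal ((norm (u X))\<^sup>2) \<partial>config_measure N) =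
    ennreal (\<Sum>\<sigma> | \<sigma> permutes {..<N}. \<Prod>n<N. \<Prod>j\<in>UNIV. (LBINT t. (norm (F (\<sigma> n) j t))\<^sup>2))"
    unfolding u_eq by (rule slater_norm_integral[of N _ N]) (auto intro: F_integrable F_orth_ex)
  then show ?thesis by (simp add: F_norm card_permutations)
qed

text \<open>Each permutation contributes the same one-particle energy bound \<open>E\<close> and the
  same pair sum \<open>H\<close>, so \<open>fact N\<close> factors out of the bounds for both
  quadratic forms.\<close>

definition E :: real where "E = (\<Sum>i<N. \<Sum>j\<in>UNIV. e (\<kappa> i $ j))"

definition H :: real where "H = (\<Sum>i<N. \<Sum>i'<N. pair_weight (p i) (p i')) / 2"

lemma e_nonneg: "e k \<ge> 0"
proof -
  have "0 \<le> (LBINT t. (norm (D1 (f k) t))\<^sup>2)" by simp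
  then show ?thesis using f_energy[of k] by linarith
qed

lemma norm_partial_u:
  assumes "n < N"
  shows "(\<integral>\<^sup>+X. ennreal ((norm (partial_deriv (n, j) u X))\<^sup>2) \<partial>config_measure N) \<le>
     ennreal (\<Sum>\<sigma> | \<sigma> permutes {..<N}. e (\<kappa> (\<sigma> n) $ j))"
proof -
  let ?\<psi> = "\<lambda>m i l. (D1 ^^ incr (n, j) (\<lambda>_ _. 0) m l) (F i l)"
  have \<psi>: "?\<psi> m i l = (if m = n \<and> l = j then D1 (F i l) else F i l)" for m i l
    by (simp add: incr_def)
  have "partial_deriv (n, j) u = slater N ?\<psi>"
    unfolding u_def partial_deriv_slater_deriv[where F=F, OF F_smooth assms] by (simp add: slater_deriv_def)
  moreover have "(\<integral>\<^sup>+X. ennreal ((norm (slater N ?\<psi> X))\<^sup>2) \<partial>config_measure N) =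
    ennreal (\<Sum>\<sigma> | \<sigma> permutes {..<N}. \<Prod>m<N. \<Prod>l\<in>UNIV. (LBINT t. (norm (?\<psi> m (\<sigma> m) l t))\<^sup>2))"
    by (rule slater_norm_integral[of N _ n]) (auto simp: \<psi> intro: F_integrable D1_F_integrable F_orth_ex)
  moreover have "(\<Prod>m<N. \<Prod>l\<in>UNIV. (LBINT t. (norm (?\<psi> m (\<sigma> m) l t))\<^sup>2)) \<le> e (\<kappa> (\<sigma> n) $ j)" for \<sigma>
  proof -
    have "(\<Prod>(m, l)\<in>({..<N} \<times> UNIV) - {(n, j)}. (LBINT t. (norm (?\<psi> m (\<sigma> m) l t))\<^sup>2)) = 1"
      by (intro prod.neutral) (auto simp: \<psi> F_norm split: if_splits)
    then show ?thesis
      unfolding prod_split_coordinate[OF assms, of _ j] using F_energy[of "\<sigma> n" j] by (simp add: \<psi>)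
  qed
  ultimately show ?thesis by (auto intro!: ennreal_leI sum_mono)
qed

lemma grad_energy_u: "grad_energy N (\<lambda>n. particle_grad n u) \<le> ennreal (fact N * E)"
proof -
  have nrm: "(norm (particle_grad n u X))\<^sup>2 = (\<Sum>j\<in>UNIV. (norm (partial_deriv (n, j) u X))\<^sup>2)" for n X
    by (simp add: norm_vec_def L2_set_def particle_grad_def sum_nonneg)
  have meas: "partial_deriv (n, j) u \<in> borel_measurable (config_measure N)" if "n < N" for n j
    unfolding u_def partial_deriv_slater_deriv[where F=F, OF F_smooth that]
    unfolding slater_deriv_def
    by (intro borel_measurable_slater borel_measurable_continuous_onI smooth_continuous smooth_iter_D1 F_smooth)
  have "grad_energy N (\<lambda>n. particle_grad n u) =
      (\<Sum>n<N. \<integral>\<^sup>+X. (\<Sum>j\<in>UNIV. ennreal ((norm (partial_deriv (n, j) u X))\<^sup>2)) \<partial>config_measure N)"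
    by (simp add: grad_energy_def nrm)
  also have "\<dots> = (\<Sum>n<N. \<Sum>j\<in>UNIV. \<integral>\<^sup>+X. ennreal ((norm (partial_deriv (n, j) u X))\<^sup>2) \<partial>config_measure N)"
    using meas by (intro sum.cong refl nn_integral_sum) auto
  also have "\<dots> \<le> (\<Sum>n<N. \<Sum>j\<in>UNIV. ennreal (\<Sum>\<sigma> | \<sigma> permutes {..<N}. e (\<kappa> (\<sigma> n) $ j)))"
    by (intro sum_mono norm_partial_u) auto
  also have "\<dots> = ennreal (\<Sum>n<N. \<Sum>j\<in>UNIV. \<Sum>\<sigma> | \<sigma> permutes {..<N}. e (\<kappa> (\<sigma> n) $ j))"
    using e_nonneg by (simp add: sum_nonneg)
  also have "(\<Sum>n<N. \<Sum>j\<in>UNIV. \<Sum>\<sigma> | \<sigma> permutes {..<N}. e (\<kappa> (\<sigma> n) $ j)) =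
      (\<Sum>\<sigma> | \<sigma> permutes {..<N}. \<Sum>n<N. \<Sum>j\<in>UNIV. e (\<kappa> (\<sigma> n) $ j))"
    by (subst (2) sum.swap, subst sum.swap) (rule refl)
  also have "\<dots> = (\<Sum>\<sigma> | \<sigma> permutes {..<N}. E)"
    unfolding E_def by (intro sum.cong refl sum_permuted[of _ N "\<lambda>i. \<Sum>j\<in>UNIV. e (\<kappa> i $ j)"]) auto
  also have "\<dots> = fact N * E" by (simp add: card_permutations)
  finally show ?thesis .
qed

text \<open>Confines particle \<open>n\<close> to cell \<open>b\<close> and particle
  \<open>m\<close> to cell \<open>c\<close> by deleting orbitals at these positions rather than by a
  factor in front; the result is again a determinant with orthogonal orbitals, to which
  \<open>slater_norm_integral\<close> applies.\<close>

definition cut :: "nat \<Rightarrow> nat \<Rightarrow> int^2 \<Rightarrow> int^2 \<Rightarrow> nat \<Rightarrow> nat \<Rightarrow> 2 \<Rightarrow> real \<Rightarrow> complex" where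
  "cut n m b c l i j t = (if (l = n \<longrightarrow> p i = b) \<and> (l = m \<longrightarrow> p i = c) then F i j t else 0)"

lemma norm_cut:
  assumes "n < N" "m < N"
  shows "(\<integral>\<^sup>+X. ennreal ((norm (slater N (cut n m b c) X))\<^sup>2) \<partial>config_measure N) =
    ennreal (\<Sum>\<sigma> | \<sigma> permutes {..<N}. of_bool (p (\<sigma> n) = b \<and> p (\<sigma> m) = c))"
proof -
  have c: "cut n m b c l i j = (if (l = n \<longrightarrow> p i = b) \<and> (l = m \<longrightarrow> p i = c) then F i j else (\<lambda>_. 0))" for l i j
    by (auto simp: cut_def fun_eq_iff)
  have "(\<integral>\<^sup>+X. ennreal ((norm (slater N (cut n m b c) X))\<^sup>2) \<partial>config_measure N) =
    ennreal (\<Sum>\<sigma> | \<sigma> permutes {..<N}. \<Prod>l<N. \<Prod>j\<in>UNIV. (LBINT t. (norm (cut n m b c l (\<sigma> l) j t))\<^sup>2))"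
    by (rule slater_norm_integral[of N _ N]) (auto simp: c intro: F_integrable F_orth_ex)
  moreover have "(\<Prod>l<N. \<Prod>j\<in>UNIV. (LBINT t. (norm (cut n m b c l (\<sigma> l) j t))\<^sup>2)) =
      of_bool (p (\<sigma> n) = b \<and> p (\<sigma> m) = c)" for \<sigma>
  proof -
    have "(\<Prod>j\<in>UNIV. (LBINT t. (norm (cut n m b c l (\<sigma> l) j t))\<^sup>2)) =
        of_bool ((l = n \<longrightarrow> p (\<sigma> l) = b) \<and> (l = m \<longrightarrow> p (\<sigma> l) = c))" for l
      by (auto simp: c F_norm)
    then have "(\<Prod>l<N. \<Prod>j\<in>UNIV. (LBINT t. (norm (cut n m b c l (\<sigma> l) j t))\<^sup>2)) =
      (\<Prod>l<N. of_bool ((l = n \<longrightarrow> p (\<sigma> l) = b) \<and> (l = m \<longrightarrow> p (\<sigma> l) = c)))" by simp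
    also have "\<dots> = of_bool (p (\<sigma> n) = b \<and> p (\<sigma> m) = c)"
    proof (cases "p (\<sigma> n) = b \<and> p (\<sigma> m) = c")
      case True then show ?thesis by (auto intro!: prod.neutral)
    next
      case False then show ?thesis using assms by (auto intro!: prod_zero)
    qed
    finally show ?thesis .
  qed
  ultimately show ?thesis by simp
qed

text \<open>In a nonvanishing term of the determinant the cell of each particle is that of its
  orbital, because an orbital lives in a single cell. Deleting orbitals therefore amounts to
  multiplying \<open>u\<close> by an indicator function.\<close>

lemma slater_cut:
  assumes "n < N" "m < N"
  shows "slater N (cut n m b c) X = (if cell (X n) = b \<and> cell (X m) = c then u X else 0)"
proof (cases "cell (X n) = b \<and> cell (X m) = c")
  case True
  have "(\<Prod>l<N. \<Prod>j\<in>UNIV. cut n m b c l (\<sigma> l) j (X l $ j)) = (\<Prod>l<N. \<Prod>j\<in>UNIV. F (\<sigma> l) j (X l $ j))" for \<sigma>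
  proof (cases "\<forall>l<N. \<forall>j. F (\<sigma> l) j (X l $ j) \<noteq> 0")
    case nz: True
    then have "cell (X l) = p (\<sigma> l)" if "l < N" for l
      using that F_nonzero by (auto simp: cell_def vec_eq_iff)
    then show ?thesis using assms True by (intro prod.cong refl) (auto simp: cut_def)
  next
    case False
    then obtain l j where l: "l < N" "F (\<sigma> l) j (X l $ j) = 0" by blast
    then have "(\<Prod>j\<in>UNIV. F (\<sigma> l) j (X l $ j)) = 0" "(\<Prod>j\<in>UNIV. cut n m b c l (\<sigma> l) j (X l $ j)) = 0"
      by (auto intro!: prod_zero exI[of _ j] simp: cut_def)
    then show ?thesis using l(1) by (metis (no_types, lifting) finite_lessThan lessThan_iff prod_zero)
  qed
  then show ?thesis using True by (simp add: slater_def u_eq)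
next
  case False
  have "(\<Prod>l<N. \<Prod>j\<in>UNIV. cut n m b c l (\<sigma> l) j (X l $ j)) = 0" for \<sigma>
  proof -
    \<comment> \<open>\<open>l\<close> is \<open>n\<close> with \<open>b' = b\<close> or
      \<open>m\<close> with \<open>b' = c\<close>, whichever particle is outside its prescribed
      cell.\<close>
    obtain l b' where l: "l < N" "cell (X l) \<noteq> b'" "\<And>i j t. p i \<noteq> b' \<Longrightarrow> cut n m b c l i j t = 0"
      using False assms by (auto simp: cut_def)
    obtain j where j: "\<lfloor>X l $ j\<rfloor> \<noteq> b' $ j" using l(2) by (auto simp: cell_def vec_eq_iff)
    have "cut n m b c l (\<sigma> l) j (X l $ j) = 0"
    proof (cases "p (\<sigma> l) = b'")
      case True
      then have "F (\<sigma> l) j (X l $ j) = 0" using j F_nonzero by blast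
      then show ?thesis by (simp add: cut_def)
    qed (use l in simp)
    then have "(\<Prod>j\<in>UNIV. cut n m b c l (\<sigma> l) j (X l $ j)) = 0" by (intro prod_zero) auto
    then show ?thesis using l(1) by (intro prod_zero) auto
  qed
  then have "slater N (cut n m b c) X = 0" unfolding slater_def by (intro sum.neutral) auto
  then show ?thesis using False by auto
qed

text \<open>Space is decomposed according to the cells of the two particles; on each piece the
  singular weight is at least the constant \<open>pair_weight b c\<close>, and by
  \<open>norm_cut\<close> the mass of \<open>u\<close> on it is a number of permutations.\<close>

lemma hardy_pair:
  assumes "n < N" "m < N"
  shows "(\<integral>\<^sup>+X. ennreal ((norm (u X))\<^sup>2 / (norm (X n - X m))\<^sup>2) \<partial>config_measure N) \<ge>
    ennreal (\<Sum>\<sigma> | \<sigma> permutes {..<N}. pair_weight (p (\<sigma> n)) (p (\<sigma> m)))"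
proof -
  let ?C = "p ` {..<N}" and ?S = "{\<sigma>. \<sigma> permutes {..<N}}"
  let ?s = "\<lambda>b c X. (norm (slater N (cut n m b c) X))\<^sup>2"
  have cutm: "slater N (cut n m b c) \<in> borel_measurable (config_measure N)" for b c
  proof (rule borel_measurable_slater)
    show "cut n m b c l i j \<in> borel_measurable borel" for l i j
    proof (cases "(l = n \<longrightarrow> p i = b) \<and> (l = m \<longrightarrow> p i = c)")
      case True
      then have "cut n m b c l i j = F i j" by (auto simp: cut_def fun_eq_iff)
      then show ?thesis by (simp add: borel_measurable_continuous_onI smooth_continuous F_smooth)
    next
      case False
      then have "cut n m b c l i j = (\<lambda>_. 0)" by (auto simp: cut_def fun_eq_iff)
      then show ?thesis by simp
    qed
  qed
  have "(\<Sum>b\<in>?C. \<Sum>c\<in>?C. pair_weight b c * ?s b c X) \<le> (norm (u X))\<^sup>2 / (norm (X n - X m))\<^sup>2" for X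
  proof -
    let ?b = "cell (X n)" and ?c = "cell (X m)"
    \<comment> \<open>At most one pair of cells contributes, that of the two particles; it is absent
      from the sum if one of these cells holds no orbital, hence the inequality that
      follows.\<close>
    have "(\<Sum>b\<in>?C. \<Sum>c\<in>?C. pair_weight b c * ?s b c X) =
        (\<Sum>b\<in>?C. \<Sum>c\<in>?C. if c = ?c then (if b = ?b then pair_weight ?b ?c * (norm (u X))\<^sup>2 else 0) else 0)"
      unfolding slater_cut[OF assms] by (intro sum.cong refl) auto
    also have "\<dots> \<le> pair_weight ?b ?c * (norm (u X))\<^sup>2"
      by (cases "?c \<in> ?C") (auto simp: sum.delta pair_weight_nonneg)
    also have "\<dots> \<le> (norm (u X))\<^sup>2 / (norm (X n - X m))\<^sup>2" by (intro pair_weight_le) simp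
    finally show ?thesis .
  qed
  then have "(\<integral>\<^sup>+X. ennreal ((norm (u X))\<^sup>2 / (norm (X n - X m))\<^sup>2) \<partial>config_measure N) \<ge>
     (\<integral>\<^sup>+X. ennreal (\<Sum>b\<in>?C. \<Sum>c\<in>?C. pair_weight b c * ?s b c X) \<partial>config_measure N)"
    by (intro nn_integral_mono ennreal_leI)
  moreover have "(\<integral>\<^sup>+X. ennreal (\<Sum>b\<in>?C. \<Sum>c\<in>?C. pair_weight b c * ?s b c X) \<partial>config_measure N) =
     (\<integral>\<^sup>+X. (\<Sum>b\<in>?C. \<Sum>c\<in>?C. ennreal (pair_weight b c) * ennreal (?s b c X)) \<partial>config_measure N)"
    by (simp add: sum_nonneg pair_weight_nonneg ennreal_mult flip: sum_ennreal)
  moreover have "\<dots> = (\<Sum>b\<in>?C. \<Sum>c\<in>?C. ennreal (pair_weight b c) *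
      (\<integral>\<^sup>+X. ennreal (?s b c X) \<partial>config_measure N))"
    using cutm by (simp add: nn_integral_sum nn_integral_cmult)
  moreover have "\<dots> = ennreal (\<Sum>b\<in>?C. \<Sum>c\<in>?C. pair_weight b c *
      (\<Sum>\<sigma>\<in>?S. of_bool (p (\<sigma> n) = b \<and> p (\<sigma> m) = c)))"
    unfolding norm_cut[OF assms]
    by (simp add: sum_nonneg pair_weight_nonneg ennreal_mult flip: sum_ennreal)
  moreover have "(\<Sum>b\<in>?C. \<Sum>c\<in>?C. pair_weight b c * (\<Sum>\<sigma>\<in>?S. of_bool (p (\<sigma> n) = b \<and> p (\<sigma> m) = c))) =
     (\<Sum>\<sigma>\<in>?S. \<Sum>b\<in>?C. \<Sum>c\<in>?C. pair_weight b c * of_bool (p (\<sigma> n) = b \<and> p (\<sigma> m) = c))"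
    unfolding sum_distrib_left by (subst (2) sum.swap, subst sum.swap) (rule refl)
  moreover have "\<dots> = (\<Sum>\<sigma>\<in>?S. pair_weight (p (\<sigma> n)) (p (\<sigma> m)))"
  proof (intro sum.cong refl)
    fix \<sigma> assume "\<sigma> \<in> ?S"
    then have C: "p (\<sigma> n) \<in> ?C" "p (\<sigma> m) \<in> ?C"
      using permutes_in_image[of \<sigma> "{..<N}"] assms by auto
    have "(\<Sum>b\<in>?C. \<Sum>c\<in>?C. pair_weight b c * of_bool (p (\<sigma> n) = b \<and> p (\<sigma> m) = c)) =
      (\<Sum>b\<in>?C. \<Sum>c\<in>?C. if c = p (\<sigma> m) then (if b = p (\<sigma> n) then pair_weight (p (\<sigma> n)) (p (\<sigma> m)) else 0) else 0)"
      by (intro sum.cong refl) auto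
    then show "(\<Sum>b\<in>?C. \<Sum>c\<in>?C. pair_weight b c * of_bool (p (\<sigma> n) = b \<and> p (\<sigma> m) = c)) =
       pair_weight (p (\<sigma> n)) (p (\<sigma> m))" using C by (simp add: sum.delta)
  qed
  ultimately show ?thesis by simp
qed

text \<open>For a fixed permutation the sum over pairs of particles is a relabelled sum over pairs
  of orbitals, hence always \<open>H\<close>.\<close>

lemma hardy_term_u: "hardy_term N u \<ge> ennreal (fact N * H)"
proof -
  let ?P = "{(n, m). n < m \<and> m < N}" and ?S = "{\<sigma>. \<sigma> permutes {..<N}}"
  have "fact N * H = (\<Sum>\<sigma>\<in>?S. H)" by (simp add: card_permutations)
  also have "\<dots> = (\<Sum>\<sigma>\<in>?S. \<Sum>(n, m)\<in>?P. pair_weight (p (\<sigma> n)) (p (\<sigma> m)))"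
  proof (intro sum.cong refl)
    fix \<sigma> assume "\<sigma> \<in> ?S"
    then have \<sigma>: "\<sigma> permutes {..<N}" by simp
    have "(\<Sum>(n, m)\<in>?P. pair_weight (p (\<sigma> n)) (p (\<sigma> m))) =
       (\<Sum>n<N. \<Sum>m<N. pair_weight (p (\<sigma> n)) (p (\<sigma> m))) / 2"
      by (rule sum_less_pairs_symmetric) (auto simp: pair_weight_def cell_dist_commute)
    also have "\<dots> = H" unfolding H_def
      by (simp only: sum_permuted[OF \<sigma>, of "\<lambda>k. pair_weight _ (p k)"]
          sum_permuted[OF \<sigma>, of "\<lambda>i. \<Sum>m<N. pair_weight (p i) (p m)"])
    finally show "H = (\<Sum>(n, m)\<in>?P. pair_weight (p (\<sigma> n)) (p (\<sigma> m)))" by simp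
  qed
  also have "\<dots> = (\<Sum>(n, m)\<in>?P. \<Sum>\<sigma>\<in>?S. pair_weight (p (\<sigma> n)) (p (\<sigma> m)))"
    by (subst sum.swap) (simp add: case_prod_beta)
  finally have "ennreal (fact N * H) =
      (\<Sum>(n, m)\<in>?P. ennreal (\<Sum>\<sigma>\<in>?S. pair_weight (p (\<sigma> n)) (p (\<sigma> m))))"
    by (simp add: case_prod_beta sum_nonneg pair_weight_nonneg)
  also have "\<dots> \<le> hardy_term N u"
    unfolding hardy_term_def using hardy_pair by (intro sum_mono) auto
  finally show ?thesis .
qed

text \<open>Being a test function, \<open>u\<close> is approximated by the constant sequence. The
  rest is a common bound on the cells and the measurability of the gradient, which is assembled from
  its components by \<open>axis\<close>.\<close>

lemma hom_sobolev_u: "hom_sobolev N u (\<lambda>n. particle_grad n u)"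
proof -
  obtain R :: real where R: "\<And>i j. i < N \<Longrightarrow> \<bar>real_of_int (p i $ j)\<bar> + 1 \<le> R"
  proof
    fix i j assume "i < N"
    have "\<bar>real_of_int (p i $ j)\<bar> \<le> (\<Sum>l\<in>UNIV. \<bar>real_of_int (p i $ l)\<bar>)"
      by (rule member_le_sum) auto
    also have "\<dots> \<le> (\<Sum>i<N. \<Sum>l\<in>UNIV. \<bar>real_of_int (p i $ l)\<bar>)"
      using \<open>i < N\<close> by (intro member_le_sum[of i "{..<N}" "\<lambda>i. \<Sum>l\<in>UNIV. \<bar>real_of_int (p i $ l)\<bar>"]) (auto intro: sum_nonneg)
    finally show "\<bar>real_of_int (p i $ j)\<bar> + 1 \<le> (\<Sum>i<N. \<Sum>l\<in>UNIV. \<bar>real_of_int (p i $ l)\<bar>) + 1" by simp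
  qed
  have test: "test_function N u"
    unfolding u_def
  proof (rule test_function_slater_deriv[where F=F, OF F_smooth])
    fix i j and t :: real assume "i < N" "\<bar>t\<bar> > R"
    then show "F i j t = 0" using R[of i j] by (intro F_vanishes) linarith
  qed
  have um: "u \<in> borel_measurable (config_measure N)"
    unfolding u_eq by (intro borel_measurable_slater borel_measurable_continuous_onI smooth_continuous F_smooth)
  have "particle_grad n u \<in> borel_measurable (config_measure N)" if "n < N" for n
  proof -
    have m: "partial_deriv (n, j) u \<in> borel_measurable (config_measure N)" for j
      unfolding u_def partial_deriv_slater_deriv[where F=F, OF F_smooth that]
      unfolding slater_deriv_def
      by (intro borel_measurable_slater borel_measurable_continuous_onI smooth_continuous smooth_iter_D1 F_smooth)
    have ax: "(axis j :: complex \<Rightarrow> complex^2) \<in> borel_measurable borel" for j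
    proof (intro borel_measurable_continuous_onI)
      have "continuous_on UNIV (\<lambda>x::complex. if i = j then x else 0)" for i
        by (cases "i = j") (auto intro: continuous_on_id)
      then show "continuous_on UNIV (axis j :: complex \<Rightarrow> complex^2)"
        unfolding axis_def by (intro continuous_on_vec_lambda)
    qed
    have "particle_grad n u = (\<lambda>X. \<Sum>j\<in>UNIV. axis j (partial_deriv (n, j) u X))"
      by (auto simp: particle_grad_def fun_eq_iff vec_eq_iff axis_def sum.delta)
    moreover have "(\<lambda>X. \<Sum>j\<in>UNIV. axis j (partial_deriv (n, j) u X)) \<in> borel_measurable (config_measure N)"
      by (intro borel_measurable_sum measurable_compose[OF m ax])
    ultimately show ?thesis by simp
  qed
  with um test show ?thesis
    unfolding hom_sobolev_def
    by (auto intro!: exI[of _ "\<lambda>_. u"] simp: grad_energy_def)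
qed

text \<open>The factor \<open>fact N\<close> cancels in the quotient of the bounds; as the squared
  norm of \<open>u\<close>, it also shows that \<open>u\<close> is not zero almost everywhere. An
  infinite Hardy term is treated apart, the quotient being 0 then.\<close>

lemma kappa_le:
  assumes "H > 0"
  shows "kappa N \<le> ennreal (E / H)"
proof -
  have E0: "E \<ge> 0" unfolding E_def by (intro sum_nonneg e_nonneg)
  have "\<not> (AE X in config_measure N. u X = 0)"
  proof
    assume "AE X in config_measure N. u X = 0"
    then have "(\<integral>\<^sup>+X. ennreal ((norm (u X))\<^sup>2) \<partial>config_measure N) = (\<integral>\<^sup>+X. 0 \<partial>config_measure N)"
      by (intro nn_integral_cong_AE) auto
    then show False unfolding norm_u by simp
  qed
  then have "kappa N \<le> grad_energy N (\<lambda>n. particle_grad n u) / hardy_term N u"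
    unfolding kappa_def using hom_sobolev_u antisymmetric_slater[of N F]
    by (intro Inf_lower) (auto simp: u_eq)
  also have "\<dots> \<le> ennreal (E / H)"
  proof (cases "hardy_term N u")
    case (real r)
    have r: "fact N * H \<le> r" using hardy_term_u real by (simp add: ennreal_le_iff)
    have fH: "fact N * H > 0" using assms by simp
    then have r0: "r > 0" using r by linarith
    have "grad_energy N (\<lambda>n. particle_grad n u) / hardy_term N u \<le> ennreal (fact N * E) / ennreal r"
      unfolding real(2) by (intro divide_right_mono_ennreal grad_energy_u)
    also have "\<dots> = ennreal (fact N * E / r)" using r0 E0 by (intro divide_ennreal) auto
    also have "fact N * E / r \<le> fact N * E / (fact N * H)"
      by (intro divide_left_mono r mult_nonneg_nonneg E0 mult_pos_pos[OF r0 fH]) simp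
    also have "\<dots> = E / H" by simp
    finally show ?thesis by (simp add: ennreal_leI)
  next
    case top
    then show ?thesis using grad_energy_u by (simp add: ennreal_divide_top)
  qed
  finally show ?thesis .
qed

end

subsection \<open>Lattice sums\<close>

text \<open>Serves twice: for the momenta in one cell and for the separations between cells.\<close>

definition lattice_disc :: "nat \<Rightarrow> (int^2) set" where
  "lattice_disc r = {v. norm (real_vec v) \<le> real r}"

lemma lattice_disc_component: "v \<in> lattice_disc r \<Longrightarrow> \<bar>v $ j\<bar> \<le> int r"
proof -
  assume "v \<in> lattice_disc r"
  then have "\<bar>real_vec v $ j\<bar> \<le> real r"
    using component_le_norm_cart[of "real_vec v" j] unfolding lattice_disc_def by simp
  then show ?thesis by (simp add: real_vec_def)
qed

lemma finite_lattice_disc: "finite (lattice_disc r)"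
proof (rule finite_imageD)
  have "- int r \<le> v $ j \<and> v $ j \<le> int r" if "v \<in> lattice_disc r" for v j
    using lattice_disc_component[OF that, of j] by linarith
  then have "(\<lambda>v. (v $ 1, v $ 2)) ` lattice_disc r \<subseteq> {- int r..int r} \<times> {- int r..int r}"
    by auto
  then show "finite ((\<lambda>v. (v $ 1, v $ 2)) ` lattice_disc r)"
    by (rule finite_subset) simp
  show "inj_on (\<lambda>v. (v $ 1, v $ 2)) (lattice_disc r)"
    by (rule inj_onI) (simp add: vec_eq_iff forall_2)
qed

lemma lattice_disc_mono: "r \<le> s \<Longrightarrow> lattice_disc r \<subseteq> lattice_disc s"
  by (auto simp: lattice_disc_def)

lemma lattice_disc_0: "lattice_disc 0 = {0}"
  unfolding lattice_disc_def by (auto simp: real_vec_def vec_eq_iff)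

lemma
  fixes a :: "real^2"
  shows emeasure_unit_box: "emeasure lborel (box a (a + 1)) = 1"
    and emeasure_unit_cbox: "emeasure lborel (cbox a (a + 1)) = 1"
proof -
  have "a \<bullet> b \<le> (a + 1) \<bullet> b" if "b \<in> Basis" for b
    using that by (auto simp: Basis_vec_def inner_axis)
  moreover have "(\<Prod>b\<in>Basis. (a + 1 - a) \<bullet> b) = 1"
    by (simp add: prod_Basis_vec inner_axis)
  ultimately show "emeasure lborel (box a (a + 1)) = 1" "emeasure lborel (cbox a (a + 1)) = 1"
    by (simp_all add: emeasure_lborel_box emeasure_lborel_cbox)
qed

text \<open>Gauss's area argument: the open unit boxes with lower corner in the disc are disjoint
  and fit into the disc of radius r + 2.\<close>

lemma card_lattice_disc_le: "real (card (lattice_disc r)) \<le> pi * (real r + 2)\<^sup>2"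
proof -
  let ?B = "\<lambda>v. box (real_vec v) (real_vec v + 1)"
  have cell: "cell x = v" if "x \<in> ?B v" for x v
  proof -
    have "of_int (v $ j) \<le> x $ j \<and> x $ j < of_int (v $ j) + 1" for j
      using that by (auto simp: mem_box_cart real_vec_def intro: less_imp_le)
    then show ?thesis by (simp add: cell_def vec_eq_iff floor_eq_iff)
  qed
  have "ennreal (card (lattice_disc r)) = (\<Sum>v\<in>lattice_disc r. emeasure lborel (?B v))"
    by (simp add: emeasure_unit_box ennreal_of_nat_eq_real_of_nat)
  also have "\<dots> = emeasure lborel (\<Union>v\<in>lattice_disc r. ?B v)"
    by (intro sum_emeasure) (auto simp: disjoint_family_on_def finite_lattice_disc dest!: cell)
  also have "\<dots> \<le> emeasure lborel (cball (0::real^2) (real r + 2))"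
  proof (intro emeasure_mono)
    show "(\<Union>v\<in>lattice_disc r. ?B v) \<subseteq> cball 0 (real r + 2)"
    proof safe
      fix v x assume v: "v \<in> lattice_disc r" and x: "x \<in> ?B v"
      have "\<bar>(x - real_vec v) $ j\<bar> \<le> 1" for j
      proof -
        have "real_vec v $ j < x $ j \<and> x $ j < real_vec v $ j + 1" using x by (auto simp: mem_box_cart)
        then show ?thesis by simp
      qed
      then have "norm (x - real_vec v) \<le> 2" by (rule norm_le_2)
      moreover have "norm x \<le> norm (x - real_vec v) + norm (real_vec v)"
        using norm_triangle_ineq[of "x - real_vec v" "real_vec v"] by simp
      ultimately show "x \<in> cball 0 (real r + 2)" using v by (simp add: lattice_disc_def)
    qed
  qed simp
  also have "\<dots> = ennreal (pi * (real r + 2)\<^sup>2)" by (simp add: emeasure_cball unit_ball_vol_2)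
  finally show ?thesis by (simp add: ennreal_le_iff)
qed

text \<open>The counterpart of the area argument with closed boxes: they cover the disc of radius r
  - 2, since the corner of the cell of a point is within distance 2 of it.\<close>

lemma card_lattice_disc_ge:
  assumes "r \<ge> 2" shows "pi * (real r - 2)\<^sup>2 \<le> real (card (lattice_disc r))"
proof -
  let ?B = "\<lambda>v. cbox (real_vec v) (real_vec v + 1)"
  have "ennreal (pi * (real r - 2)\<^sup>2) = emeasure lborel (cball (0::real^2) (real r - 2))"
    using assms by (simp add: emeasure_cball unit_ball_vol_2)
  also have "\<dots> \<le> emeasure lborel (\<Union>v\<in>lattice_disc r. ?B v)"
  proof (intro emeasure_mono)
    show "cball 0 (real r - 2) \<subseteq> (\<Union>v\<in>lattice_disc r. ?B v)"
    proof
      fix x :: "real^2" assume x: "x \<in> cball 0 (real r - 2)"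
      have c: "real_vec (cell x) $ j \<le> x $ j \<and> x $ j \<le> real_vec (cell x) $ j + 1" for j
        unfolding real_vec_def cell_def by simp
      then have "\<bar>(real_vec (cell x) - x) $ j\<bar> \<le> 1" for j by (simp add: abs_le_iff) (smt (verit))
      then have "norm (real_vec (cell x) - x) \<le> 2" by (rule norm_le_2)
      moreover have "norm (real_vec (cell x)) \<le> norm (real_vec (cell x) - x) + norm x"
        using norm_triangle_ineq[of "real_vec (cell x) - x" x] by simp
      ultimately have "cell x \<in> lattice_disc r" using x by (simp add: lattice_disc_def)
      moreover have "x \<in> ?B (cell x)" using c by (simp add: mem_box_cart)
      ultimately show "x \<in> (\<Union>v\<in>lattice_disc r. ?B v)" by blast
    qed
  qed (auto intro!: sets.finite_UN finite_lattice_disc)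
  also have "\<dots> \<le> (\<Sum>v\<in>lattice_disc r. emeasure lborel (?B v))"
    by (intro emeasure_subadditive_finite finite_lattice_disc) auto
  also have "\<dots> = ennreal (card (lattice_disc r))"
    by (simp add: emeasure_unit_cbox ennreal_of_nat_eq_real_of_nat)
  finally show ?thesis by (simp add: ennreal_le_iff)
qed

lemma card_lattice_disc_ge': "pi * ((real r)\<^sup>2 - 4 * real r) \<le> real (card (lattice_disc r))"
proof (cases "r \<ge> 4")
  case True
  have "pi * ((real r)\<^sup>2 - 4 * real r) \<le> pi * (real r - 2)\<^sup>2"
    by (intro mult_left_mono) (auto simp: power2_eq_square algebra_simps)
  then show ?thesis using card_lattice_disc_ge[of r] True by linarith
next
  case False
  then have "real r * (real r - 4) \<le> 0" by (intro mult_nonneg_nonpos) auto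
  then have "pi * ((real r)\<^sup>2 - 4 * real r) \<le> 0"
    by (intro mult_nonneg_nonpos) (auto simp: power2_eq_square algebra_simps)
  then show ?thesis by linarith
qed

section \<open>Summation by parts over circular shells\<close>

lemma sum_lattice_disc_Suc:
  fixes g :: "int^2 \<Rightarrow> real"
  shows "(\<Sum>v\<in>lattice_disc (Suc r). g v) =
    (\<Sum>v\<in>lattice_disc r. g v) + (\<Sum>v\<in>lattice_disc (Suc r) - lattice_disc r. g v)"
  using sum.subset_diff[OF lattice_disc_mono[of r "Suc r"] finite_lattice_disc, of g] by simp

lemma card_lattice_shell:
  "real (card (lattice_disc (Suc r) - lattice_disc r)) =
    real (card (lattice_disc (Suc r))) - real (card (lattice_disc r))"
  using lattice_disc_mono[of r "Suc r"] finite_lattice_disc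
  by (simp add: card_Diff_subset card_mono of_nat_diff)

text \<open>Abel summation: each new shell is weighted by its outer radius squared, and 2 r + 1 is
  the increment of r^2. Only numbers of lattice points remain on the right.\<close>

lemma sum_norm_sq_abel:
  "(\<Sum>v\<in>lattice_disc R. (norm (real_vec v))\<^sup>2) \<le>
    (real R)\<^sup>2 * card (lattice_disc R) - (\<Sum>r<R. (2 * real r + 1) * card (lattice_disc r))"
proof (induction R)
  case 0 then show ?case by (simp add: lattice_disc_0 real_vec_def norm_vec_def L2_set_def)
next
  case (Suc R)
  have "(\<Sum>v\<in>lattice_disc (Suc R) - lattice_disc R. (norm (real_vec v))\<^sup>2) \<le>
      (\<Sum>v\<in>lattice_disc (Suc R) - lattice_disc R. (real (Suc R))\<^sup>2)"
    by (intro sum_mono power_mono) (auto simp: lattice_disc_def)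
  also have "\<dots> = (real R + 1)\<^sup>2 * (real (card (lattice_disc (Suc R))) - real (card (lattice_disc R)))"
    by (simp add: card_lattice_shell algebra_simps)
  finally show ?case using Suc unfolding sum_lattice_disc_Suc
    by (simp add: power2_eq_square algebra_simps)
qed

text \<open>The leading term pi R^4 / 2 is the integral of |x|^2 over the disc. The upper count is
  used in the boundary term, the lower count in the subtracted sum.\<close>

lemma sum_norm_sq_le:
  "(\<Sum>v\<in>lattice_disc R. (norm (real_vec v))\<^sup>2) \<le> pi * (real R ^ 4 / 2 + 14 * real R ^ 3 + 4 * (real R)\<^sup>2)"
proof -
  \<comment> \<open>The summands are 2 r^3 to leading order, which gives R^4 / 2; the coefficient 10
    is generous, so that the induction step holds for every R. Later 14 = 10 + 4.\<close>
  have "real R ^ 4 / 2 - 10 * real R ^ 3 \<le> (\<Sum>r<R. (2 * real r + 1) * ((real r)\<^sup>2 - 4 * real r))"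
  proof (induction R)
    case (Suc R)
    have "real (Suc R) ^ 4 / 2 - 10 * real (Suc R) ^ 3 - (real R ^ 4 / 2 - 10 * real R ^ 3) \<le>
        (2 * real R + 1) * ((real R)\<^sup>2 - 4 * real R)"
      by (simp add: power2_eq_square power3_eq_cube power4_eq_xxxx algebra_simps)
    then show ?case using Suc by simp
  qed simp
  then have "pi * (real R ^ 4 / 2 - 10 * real R ^ 3) \<le> pi * (\<Sum>r<R. (2 * real r + 1) * ((real r)\<^sup>2 - 4 * real r))"
    by (intro mult_left_mono) auto
  also have "\<dots> = (\<Sum>r<R. (2 * real r + 1) * (pi * ((real r)\<^sup>2 - 4 * real r)))"
    by (simp add: sum_distrib_left mult_ac)
  also have "\<dots> \<le> (\<Sum>r<R. (2 * real r + 1) * card (lattice_disc r))"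
    by (intro sum_mono mult_left_mono card_lattice_disc_ge') auto
  finally have 1: "pi * (real R ^ 4 / 2 - 10 * real R ^ 3) \<le> (\<Sum>r<R. (2 * real r + 1) * card (lattice_disc r))" .
  have 2: "(real R)\<^sup>2 * card (lattice_disc R) \<le> (real R)\<^sup>2 * (pi * (real R + 2)\<^sup>2)"
    by (intro mult_left_mono card_lattice_disc_le) auto
  have "(\<Sum>v\<in>lattice_disc R. (norm (real_vec v))\<^sup>2) \<le>
      (real R)\<^sup>2 * (pi * (real R + 2)\<^sup>2) - pi * (real R ^ 4 / 2 - 10 * real R ^ 3)"
    using sum_norm_sq_abel[of R] 1 2 by linarith
  also have "\<dots> = pi * (real R ^ 4 / 2 + 14 * real R ^ 3 + 4 * (real R)\<^sup>2)"
    by (simp add: power2_eq_square power3_eq_cube power4_eq_xxxx algebra_simps)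
  finally show ?thesis .
qed

text \<open>Abel summation for a decreasing weight: in the shell beyond L the norm is at most L + 1,
  so the weight is at least 1 / (L + 3)^2.\<close>

lemma sum_inverse_sq_abel:
  "(\<Sum>v\<in>lattice_disc L. 1 / (norm (real_vec v) + 2)\<^sup>2) \<ge>
    card (lattice_disc L) / (real L + 2)\<^sup>2
     + (\<Sum>r<L. card (lattice_disc r) * (1 / (real r + 2)\<^sup>2 - 1 / (real r + 3)\<^sup>2))"
proof (induction L)
  case 0 then show ?case by (simp add: lattice_disc_0 real_vec_def norm_vec_def L2_set_def)
next
  case (Suc L)
  have "(\<Sum>v\<in>lattice_disc (Suc L) - lattice_disc L. 1 / (norm (real_vec v) + 2)\<^sup>2) \<ge>
      (\<Sum>v\<in>lattice_disc (Suc L) - lattice_disc L. 1 / (real L + 3)\<^sup>2)"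
  proof (intro sum_mono divide_left_mono power_mono mult_pos_pos)
    show "0 < (norm (real_vec v) + 2)\<^sup>2" for v
      using norm_ge_zero[of "real_vec v"] by (intro zero_less_power) linarith
  qed (auto simp: lattice_disc_def)
  moreover have "(\<Sum>v\<in>lattice_disc (Suc L) - lattice_disc L. 1 / (real L + 3)\<^sup>2) =
     (real (card (lattice_disc (Suc L))) - real (card (lattice_disc L))) * (1 / (real L + 3)\<^sup>2)"
    by (simp add: card_lattice_shell)
  moreover have "real (Suc L) + 2 = real L + 3" by simp
  ultimately show ?case using Suc unfolding sum_lattice_disc_Suc sum.lessThan_Suc
    by (simp add: algebra_simps diff_divide_distrib)
qed

text \<open>The left-hand side is \<open>2 / x + O(1 / x^2)\<close>; the generous constant \<open>40\<close> makes the second-order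
  term harmless for all \<open>x \<ge> 1\<close>, and the right-hand side telescopes.\<close>

lemma abel_term_ge:
  fixes x :: real assumes "x \<ge> 1"
  shows "(x\<^sup>2 - 4 * x) * (1 / (x + 2)\<^sup>2 - 1 / (x + 3)\<^sup>2) \<ge>
    (2 * ln (x + 1) + 40 / (x + 1)) - (2 * ln x + 40 / x)"
proof -
  have "ln (x + 1) - ln x = ln ((x + 1) / x)"
    using assms by (simp add: ln_div)
  also have "(x + 1) / x = 1 + 1 / x" using assms by (simp add: field_simps)
  also have "ln (1 + 1 / x) \<le> 1 / x" using assms by (intro ln_add_one_self_le_self) auto
  finally have ln: "ln (x + 1) - ln x \<le> 1 / x" .
  have nz: "x \<noteq> 0" "x + 1 \<noteq> 0" using assms by auto
  have "2 * (1 / x) + 40 / (x + 1) - 40 / x = (2 * x - 38) / (x * (x + 1))"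
    using nz by (simp add: divide_simps)
  also have "\<dots> \<le> (x\<^sup>2 - 4 * x) * (2 * x + 5) / ((x + 2)\<^sup>2 * (x + 3)\<^sup>2)"
  proof -
    have "(x\<^sup>2 - 4 * x) * (2 * x + 5) * (x * (x + 1)) - (2 * x - 38) * ((x + 2)\<^sup>2 * (x + 3)\<^sup>2) =
       17 * x^4 + 283 * x^3 + 1266 * x\<^sup>2 + 2208 * x + 1368"
      by (simp add: power2_eq_square power3_eq_cube power4_eq_xxxx algebra_simps)
    also have "\<dots> \<ge> 0" using assms by simp
    finally have "(2 * x - 38) * ((x + 2)\<^sup>2 * (x + 3)\<^sup>2) \<le> (x\<^sup>2 - 4 * x) * (2 * x + 5) * (x * (x + 1))"
      by simp
    moreover have "x * (x + 1) > 0" "(x + 2)\<^sup>2 * (x + 3)\<^sup>2 > 0" using assms by auto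
    ultimately show ?thesis
      by (simp add: pos_divide_le_eq pos_le_divide_eq del: zero_less_mult_iff mult_pos_pos)
  qed
  also have "\<dots> = (x\<^sup>2 - 4 * x) * (1 / (x + 2)\<^sup>2 - 1 / (x + 3)\<^sup>2)"
  proof -
    have "1 / (x + 2)\<^sup>2 - 1 / (x + 3)\<^sup>2 = (2 * x + 5) / ((x + 2)\<^sup>2 * (x + 3)\<^sup>2)"
      using assms by (simp add: diff_frac_eq) (simp add: power2_eq_square algebra_simps)
    then show ?thesis by simp
  qed
  finally show ?thesis using ln by linarith
qed

text \<open>A shell of radius r has about 2 pi r points of weight 1 / r^2, whence 2 pi ln L. The
  subtracted 40 is the value at 1 of the telescoping expression in
  \<open>abel_term_ge\<close>.\<close>

lemma sum_inverse_sq_ge: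
  assumes "L \<ge> 1"
  shows "(\<Sum>v\<in>lattice_disc L. 1 / (norm (real_vec v) + 2)\<^sup>2) \<ge> pi * (2 * ln L - 40)"
proof -
  let ?w = "\<lambda>r. 1 / (real r + 2)\<^sup>2 - 1 / (real r + 3)\<^sup>2"
  have w: "?w r \<ge> 0" for r
    by (simp add: divide_left_mono power_mono)
  \<comment> \<open>The term r = 0 vanishes, so at L = 1 both sides are 0, and
    \<open>abel_term_ge\<close> is only called from 1 on.\<close>
  have "(\<Sum>r<L. ((real r)\<^sup>2 - 4 * real r) * ?w r) \<ge> 2 * ln L + 40 / L - 40"
    using assms
  proof (induction L rule: dec_induct)
    case base then show ?case by simp
  next
    case (step L)
    then show ?case using abel_term_ge[of "real L"] by (simp add: add.commute)
  qed
  moreover have "40 / real L \<ge> 0" by simp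
  ultimately have "2 * ln L - 40 \<le> (\<Sum>r<L. ((real r)\<^sup>2 - 4 * real r) * ?w r)" by linarith
  then have "pi * (2 * ln L - 40) \<le> pi * (\<Sum>r<L. ((real r)\<^sup>2 - 4 * real r) * ?w r)"
    by (intro mult_left_mono) auto
  also have "\<dots> = (\<Sum>r<L. (pi * ((real r)\<^sup>2 - 4 * real r)) * ?w r)"
    by (simp add: sum_distrib_left mult_ac)
  also have "\<dots> \<le> (\<Sum>r<L. card (lattice_disc r) * ?w r)"
    by (intro sum_mono mult_right_mono card_lattice_disc_ge' w)
  also have "\<dots> \<le> (\<Sum>v\<in>lattice_disc L. 1 / (norm (real_vec v) + 2)\<^sup>2)"
  proof -
    have "card (lattice_disc L) / (real L + 2)\<^sup>2 \<ge> 0" by simp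
    then show ?thesis using sum_inverse_sq_abel[of L] by linarith
  qed
  finally show ?thesis .
qed

section \<open>Square grids of cells\<close>

definition grid :: "nat \<Rightarrow> (int^2) set" where
  "grid M = {v. \<forall>j. 0 \<le> v $ j \<and> v $ j < int M}"

lemma pair_weight_translate:
  "pair_weight q (q + v) = (if v = 0 then 0 else 1 / (norm (real_vec v) + 2)\<^sup>2)"
proof -
  have "real_vec (q - (q + v)) = - real_vec v" by (simp add: real_vec_def vec_eq_iff)
  then show ?thesis by (simp add: pair_weight_def cell_dist_def)
qed

text \<open>Enumerates cells row by row. The indices below \<open>M * M\<close> fill
  \<open>grid M\<close>; the enumeration stays injective beyond that, in further rows, which take
  the particles in excess of a full grid.\<close>

definition grid_vec :: "nat \<Rightarrow> nat \<Rightarrow> int^2" where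
  "grid_vec M c = (\<chi> j. if j = 1 then int (c mod M) else int (c div M))"

lemma inj_grid_vec: "grid_vec M c = grid_vec M c' \<Longrightarrow> c = c'"
proof -
  assume eq: "grid_vec M c = grid_vec M c'"
  have "c mod M = c' mod M"
    using arg_cong[OF eq, of "\<lambda>v. v $ 1"] by (simp add: grid_vec_def flip: of_nat_mod)
  moreover have "c div M = c' div M"
    using arg_cong[OF eq, of "\<lambda>v. v $ 2"] by (simp add: grid_vec_def flip: of_nat_div)
  ultimately show "c = c'" by (metis div_mult_mod_eq)
qed

lemma grid_vec_image:
  "grid_vec M ` {..<M * M} = grid M"
proof (intro equalityI subsetI)
  fix v assume "v \<in> grid_vec M ` {..<M * M}"
  then obtain c where c: "c < M * M" "v = grid_vec M c" by auto
  then have "M > 0" by (cases M) auto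
  then show "v \<in> grid M" using c less_mult_imp_div_less[of c M M]
    by (auto simp: grid_def grid_vec_def simp flip: of_nat_mod of_nat_div)
next
  fix v assume v: "v \<in> grid M"
  define a b where "a = nat (v $ 1)" and "b = nat (v $ 2)"
  have ab: "a < M" "b < M" "v $ 1 = int a" "v $ 2 = int b" using v by (auto simp: grid_def a_def b_def nat_less_iff)
  have "v = grid_vec M (a + M * b)"
    using ab by (auto simp: grid_vec_def vec_eq_iff forall_2 simp flip: of_nat_mod of_nat_div)
  moreover have "a + M * b < M * M"
  proof -
    have "a + M * b < M * Suc b" using ab by simp
    also have "\<dots> \<le> M * M" using ab by (intro mult_left_mono) auto
    finally show ?thesis .
  qed
  ultimately show "v \<in> grid_vec M ` {..<M * M}" by auto
qed

lemma finite_grid: "finite (grid M)"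
  using grid_vec_image[of M] by (metis finite_imageI finite_lessThan)

lemma card_grid: "card (grid M) = M * M"
  unfolding grid_vec_image[symmetric]
  by (subst card_image) (auto intro: inj_onI dest: inj_grid_vec)

text \<open>As first member of a pair only the cells at distance at least L from the boundary are
  counted, \<open>(B - 2) * L\<close> in each direction; each of them sees a full disc of cells of
  radius L. With B fixed, having ln L in place of ln (B L) costs a constant only.\<close>

lemma sum_grid_pair_weight_ge:
  assumes "L \<ge> 1" "B \<ge> 2"
  shows "(\<Sum>q\<in>grid (B * L). \<Sum>q'\<in>grid (B * L). pair_weight q q') \<ge>
    (real ((B - 2) * L))\<^sup>2 * (pi * (2 * ln L - 40) - 1/4)"
proof -
  let ?G = "grid (B * L)" and ?I = "(\<lambda>v. v + (\<chi> j. int L)) ` grid ((B - 2) * L)"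
  have BL: "int (B * L) = int ((B - 2) * L) + 2 * int L"
    using assms by (simp add: of_nat_diff algebra_simps flip: of_nat_mult of_nat_add)
  have inner: "(\<Sum>q'\<in>?G. pair_weight q q') \<ge> pi * (2 * ln L - 40) - 1/4" if q: "q \<in> ?I" for q
  proof -
    have sub: "(\<lambda>v. q + v) ` lattice_disc L \<subseteq> ?G"
    proof safe
      fix v assume "v \<in> lattice_disc L"
      then have "\<bar>v $ j\<bar> \<le> int L" for j by (rule lattice_disc_component)
      moreover have "int L \<le> q $ j \<and> q $ j < int ((B - 2) * L) + int L" for j
        using q by (auto simp: grid_def)
      ultimately have "0 \<le> q $ j + v $ j \<and> q $ j + v $ j < int (B * L)" for j
        unfolding BL by (smt (verit))
      then show "q + v \<in> ?G" by (simp add: grid_def)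
    qed
    have "(\<Sum>v\<in>lattice_disc L. pair_weight q (q + v)) =
        (\<Sum>v\<in>lattice_disc L - {0}. 1 / (norm (real_vec v) + 2)\<^sup>2)"
      unfolding pair_weight_translate
      by (intro sum.mono_neutral_cong_right) (auto simp: finite_lattice_disc)
    \<comment> \<open>1/4 is the term v = 0, which \<open>pair_weight\<close> omits.\<close>
    also have "\<dots> = (\<Sum>v\<in>lattice_disc L. 1 / (norm (real_vec v) + 2)\<^sup>2) - 1/4"
      by (subst sum_diff1[OF finite_lattice_disc]) (auto simp: lattice_disc_def real_vec_def norm_vec_def L2_set_def)
    finally have "pi * (2 * ln L - 40) - 1/4 \<le> (\<Sum>v\<in>lattice_disc L. pair_weight q (q + v))"
      using sum_inverse_sq_ge[OF assms(1)] by simp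
    also have "\<dots> = (\<Sum>q'\<in>(\<lambda>v. q + v) ` lattice_disc L. pair_weight q q')"
      by (subst sum.reindex) (auto simp: inj_on_def)
    also have "\<dots> \<le> (\<Sum>q'\<in>?G. pair_weight q q')"
      by (intro sum_mono2 finite_grid sub pair_weight_nonneg)
    finally show ?thesis .
  qed
  have sub: "?I \<subseteq> ?G"
  proof safe
    fix v assume "v \<in> grid ((B - 2) * L)"
    then have "0 \<le> v $ j \<and> v $ j < int ((B - 2) * L)" for j by (simp add: grid_def)
    then have "0 \<le> v $ j + int L \<and> v $ j + int L < int (B * L)" for j unfolding BL by (smt (verit) of_nat_0_le_iff)
    then show "v + (\<chi> j. int L) \<in> ?G" by (simp add: grid_def)
  qed
  have "(real ((B - 2) * L))\<^sup>2 * (pi * (2 * ln L - 40) - 1/4) = (\<Sum>q\<in>?I. pi * (2 * ln L - 40) - 1/4)"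
    by (subst sum.reindex) (auto simp: inj_on_def card_grid power2_eq_square)
  also have "\<dots> \<le> (\<Sum>q\<in>?I. \<Sum>q'\<in>?G. pair_weight q q')" by (intro sum_mono inner)
  also have "\<dots> \<le> (\<Sum>q\<in>?G. \<Sum>q'\<in>?G. pair_weight q q')"
    by (intro sum_mono2 finite_grid sub sum_nonneg pair_weight_nonneg)
  finally show ?thesis .
qed

subsection \<open>The thermodynamic limit\<close>

lemma sum_div_blocks:
  fixes h :: "nat \<Rightarrow> 'a::semiring_1"
  assumes "n > 0"
  shows "(\<Sum>i<n * q. h (i div n)) = of_nat n * (\<Sum>c<q. h c)"
proof -
  have "(\<Sum>c<q. \<Sum>i\<in>{c * n..<c * n + n}. h (i div n)) = (\<Sum>i<q * n. h (i div n))"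
    by (rule sum.nat_group)
  moreover have "(\<Sum>i\<in>{c * n..<c * n + n}. h (i div n)) = of_nat n * h c" for c
  proof -
    have "i div n = c" if "i \<in> {c * n..<c * n + n}" for i
      using that assms by (intro div_nat_eqI) (auto simp: mult.commute)
    then have "(\<Sum>i\<in>{c * n..<c * n + n}. h (i div n)) = (\<Sum>i\<in>{c * n..<c * n + n}. h c)"
      by (intro sum.cong) auto
    then show ?thesis by simp
  qed
  ultimately show ?thesis by (simp add: sum_distrib_left mult.commute)
qed

lemma sum_mod_blocks_le:
  fixes g :: "nat \<Rightarrow> real"
  assumes "n > 0" "\<And>a. g a \<ge> 0"
  shows "(\<Sum>i<N. g (i mod n)) \<le> real (N div n + 1) * (\<Sum>a<n. g a)"
proof -
  have blk: "(\<Sum>i\<in>{c * n..<c * n + n}. g (i mod n)) = (\<Sum>a<n. g a)" for c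
    using sum.shift_bounds_nat_ivl[of "\<lambda>i. g (i mod n)" 0 "c * n" n]
    by (simp add: add.commute atLeast0LessThan)
  have "(\<Sum>i<N. g (i mod n)) \<le> (\<Sum>i<(N div n + 1) * n. g (i mod n))"
    using assms dividend_less_div_times[of n N] by (intro sum_mono2) (auto simp: algebra_simps)
  also have "\<dots> = (\<Sum>c<N div n + 1. \<Sum>i\<in>{c * n..<c * n + n}. g (i mod n))"
    by (rule sum.nat_group[symmetric])
  also have "\<dots> = real (N div n + 1) * (\<Sum>a<n. g a)" by (simp add: blk)
  finally show ?thesis .
qed

lemma sum_vec2: "(\<Sum>j\<in>(UNIV::2 set). (real_of_int (v $ j))\<^sup>2) = (norm (real_vec v))\<^sup>2"
  by (simp add: norm_vec_def L2_set_def real_vec_def sum_nonneg)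

text \<open>Orbital \<open>i\<close> gets cell number \<open>i div n\<close> and momentum number
  \<open>i mod n\<close>. The energy is counted as if B^2 (L + 1)^2 cells were full, the interaction
  for the B^2 L^2 full cells of the grid only; the two numbers agree to leading order as L
  grows.\<close>

lemma kappa_le_blocks:
  fixes A \<eta> :: real
  assumes f: "orbital_family \<eta> A f"
    and n: "n = card (lattice_disc R)"
    and L: "L \<ge> 1" "B \<ge> 3" "pi * (2 * ln L - 40) - 1/4 > 0"
    and N: "n * (B * L)\<^sup>2 \<le> N" "N < n * (B * (L + 1))\<^sup>2"
  shows "kappa N \<le> ennreal ((real B * (real L + 1))\<^sup>2 *
      (2 * A * n + (1 + \<eta>) * 4 * pi\<^sup>2 * (\<Sum>v\<in>lattice_disc R. (norm (real_vec v))\<^sup>2)) /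
      ((real n)\<^sup>2 * ((real B - 2) * L)\<^sup>2 * (pi * (2 * ln L - 40) - 1/4) / 2))"
proof -
  define e where "e = (\<lambda>k::int. A + (1 + \<eta>) * 4 * pi\<^sup>2 * (of_int k)\<^sup>2)"
  have "0 \<in> lattice_disc R" using lattice_disc_mono[of 0 R] by (simp add: lattice_disc_0)
  then have n0: "n > 0" unfolding n using finite_lattice_disc by (auto simp: card_gt_0_iff)
  obtain w where w: "bij_betw w {..<n} (lattice_disc R)"
    using ex_bij_betw_nat_finite[OF finite_lattice_disc[of R]] n by (auto simp: atLeast0LessThan)
  define p where "p = (\<lambda>i. grid_vec (B * L) (i div n))"
  define \<kappa> where "\<kappa> = (\<lambda>i. w (i mod n))"
  interpret cell_orbitals f e N p \<kappa>
  proof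
    fix i i' assume "p i = p i'" "\<kappa> i = \<kappa> i'"
    then have "i div n = i' div n" "i mod n = i' mod n"
      using inj_grid_vec bij_betw_imp_inj_on[OF w] n0 by (auto simp: p_def \<kappa>_def inj_on_def)
    then show "i = i'" by (metis div_mult_mod_eq)
  qed (use f in \<open>auto simp: e_def orbital_family_def\<close>)
  let ?S = "\<Sum>v\<in>lattice_disc R. (norm (real_vec v))\<^sup>2"
  let ?E = "2 * A * n + (1 + \<eta>) * 4 * pi\<^sup>2 * ?S"
  let ?T = "pi * (2 * ln L - 40) - 1/4"
  define g where "g = (\<lambda>a. \<Sum>j\<in>UNIV. e (w a $ j))"
  have g: "g a = 2 * A + (1 + \<eta>) * 4 * pi\<^sup>2 * (norm (real_vec (w a)))\<^sup>2" for a
    unfolding g_def e_def by (simp add: sum.distrib sum_vec2 flip: sum_distrib_left)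
  have g0: "g a \<ge> 0" for a unfolding g_def by (intro sum_nonneg e_nonneg)
  have gsum: "(\<Sum>a<n. g a) = ?E"
    unfolding g sum.distrib sum_distrib_left[symmetric]
      sum.reindex_bij_betw[OF w, of "\<lambda>v. (norm (real_vec v))\<^sup>2"] by simp
  then have E0: "?E \<ge> 0" using g0 by (metis sum_nonneg)
  have "N div n + 1 \<le> (B * (L + 1))\<^sup>2"
    using N(2) n0 by (simp add: div_less_iff_less_mult mult.commute Suc_le_eq)
  then have cells: "real (N div n + 1) \<le> (real B * (real L + 1))\<^sup>2"
    by (metis of_nat_le_iff of_nat_power of_nat_mult of_nat_add of_nat_1)
  have E: "E \<le> (real B * (real L + 1))\<^sup>2 * ?E"
  proof -
    have "E = (\<Sum>i<N. g (i mod n))" by (simp only: E_def g_def) (simp add: \<kappa>_def)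
    also have "\<dots> \<le> real (N div n + 1) * ?E"
      using sum_mod_blocks_le[where g=g, OF n0 g0] gsum by simp
    also have "\<dots> \<le> (real B * (real L + 1))\<^sup>2 * ?E" by (intro mult_right_mono cells E0)
    finally show ?thesis .
  qed
  have H: "H \<ge> (real n)\<^sup>2 * ((real B - 2) * L)\<^sup>2 * ?T / 2"
  proof -
    let ?M = "(B * L) * (B * L)" and ?G = "grid (B * L)"
    have sub: "{..<n * ?M} \<subseteq> {..<N}" using N(1) by (auto simp: power2_eq_square)
    have G: "(\<Sum>c<?M. h (grid_vec (B * L) c)) = (\<Sum>q\<in>?G. h q)" for h :: "int^2 \<Rightarrow> real"
      unfolding grid_vec_image[symmetric]
      by (subst sum.reindex) (auto intro: inj_onI dest: inj_grid_vec)
    have "(real n)\<^sup>2 * (\<Sum>q\<in>?G. \<Sum>q'\<in>?G. pair_weight q q') =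
        (\<Sum>i<n * ?M. \<Sum>i'<n * ?M. pair_weight (p i) (p i'))"
      unfolding p_def
        sum_div_blocks[OF n0, of "\<lambda>c. pair_weight _ (grid_vec (B * L) c)"] G
        sum_distrib_left[symmetric]
        sum_div_blocks[OF n0, of "\<lambda>c. \<Sum>q\<in>?G. pair_weight (grid_vec (B * L) c) q"]
        G[of "\<lambda>q. \<Sum>q'\<in>?G. pair_weight q q'"]
      by (simp add: power2_eq_square)
    \<comment> \<open>Pairs with a particle outside the full grid have been left out; restoring them
      can only increase the sum.\<close>
    also have "\<dots> \<le> (\<Sum>i<n * ?M. \<Sum>i'<N. pair_weight (p i) (p i'))"
      by (intro sum_mono sum_mono2 sub pair_weight_nonneg) auto
    also have "\<dots> \<le> 2 * H"
      unfolding H_def using sub by (auto intro!: sum_mono2 sum_nonneg pair_weight_nonneg)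
    finally have "(real n)\<^sup>2 * (\<Sum>q\<in>?G. \<Sum>q'\<in>?G. pair_weight q q') \<le> 2 * H" .
    moreover have "(real n)\<^sup>2 * (((real B - 2) * L)\<^sup>2 * ?T) \<le>
        (real n)\<^sup>2 * (\<Sum>q\<in>?G. \<Sum>q'\<in>?G. pair_weight q q')"
    proof (rule mult_left_mono)
      have "real ((B - 2) * L) = (real B - 2) * L" using L by (simp add: of_nat_diff)
      then show "((real B - 2) * L)\<^sup>2 * ?T \<le> (\<Sum>q\<in>?G. \<Sum>q'\<in>?G. pair_weight q q')"
        using sum_grid_pair_weight_ge[of L B] L by simp
    qed simp
    ultimately show ?thesis by (simp add: mult.assoc)
  qed
  have D: "(real n)\<^sup>2 * ((real B - 2) * L)\<^sup>2 * ?T / 2 > 0"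
    using n0 L by (intro divide_pos_pos mult_pos_pos zero_less_power) auto
  have "E / H \<le> (real B * (real L + 1))\<^sup>2 * ?E / ((real n)\<^sup>2 * ((real B - 2) * L)\<^sup>2 * ?T / 2)"
    using D by (intro frac_le mult_nonneg_nonneg E0 E H) auto
  moreover have "H > 0" using D H by linarith
  ultimately show ?thesis using kappa_le by (meson ennreal_leI order_trans)
qed

text \<open>With n ~ pi R^2 the momenta cost about 2 pi n^2, while the term with A is only linear in
  n. Passing from \<eta> to 2 \<eta> leaves room for the lower-order terms.\<close>

lemma energy_density_limit:
  fixes A \<eta> :: real
  assumes "\<eta> > 0" "A \<ge> 0"
  shows "\<exists>R\<ge>3. 2 * A * card (lattice_disc R) + (1 + \<eta>) * 4 * pi\<^sup>2 * (\<Sum>v\<in>lattice_disc R. (norm (real_vec v))\<^sup>2)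
     \<le> 2 * pi * (1 + 2 * \<eta>) * (real (card (lattice_disc R)))\<^sup>2"
proof -
  \<comment> \<open>An upper bound for the left-hand side over n^2: n is replaced by its lower bound
    pi (R - 2)^2 and the momentum sum by its upper bound.\<close>
  let ?X = "\<lambda>R::nat. (2 * A) / (pi * (real R - 2)\<^sup>2) +
     (1 + \<eta>) * 4 * pi * (real R ^ 4 / 2 + 14 * real R ^ 3 + 4 * (real R)\<^sup>2) / (real R - 2) ^ 4"
  have "?X \<longlonglongrightarrow> (1 + \<eta>) * 4 * pi * (1/2)"
  proof -
    have "(\<lambda>R::nat. (2 * A) / (pi * (real R - 2)\<^sup>2)) \<longlonglongrightarrow> 0" by real_asymp
    moreover have "(\<lambda>R::nat. (real R ^ 4 / 2 + 14 * real R ^ 3 + 4 * (real R)\<^sup>2) / (real R - 2) ^ 4) \<longlonglongrightarrow> 1/2"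
      by real_asymp
    ultimately show ?thesis
      using tendsto_add[of _ 0 _ _ "(1 + \<eta>) * 4 * pi * (1/2)"] tendsto_mult_left[of _ "1/2" _ "(1 + \<eta>) * 4 * pi"]
      by (fastforce simp: algebra_simps)
  qed
  moreover have "(1 + \<eta>) * 4 * pi * (1/2) < 2 * pi * (1 + 2 * \<eta>)" using assms by (simp add: algebra_simps)
  ultimately have "\<forall>\<^sub>F R in sequentially. ?X R < 2 * pi * (1 + 2 * \<eta>)" by (rule order_tendstoD)
  then have "\<forall>\<^sub>F R in sequentially. R \<ge> 3 \<and> ?X R < 2 * pi * (1 + 2 * \<eta>)"
    by (intro eventually_conj eventually_ge_at_top)
  then obtain R where R: "R \<ge> 3" "?X R < 2 * pi * (1 + 2 * \<eta>)"
    using eventually_happens'[OF sequentially_bot] by blast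
  let ?n = "real (card (lattice_disc R))" and ?y = "pi * (real R - 2)\<^sup>2"
    and ?P = "real R ^ 4 / 2 + 14 * real R ^ 3 + 4 * (real R)\<^sup>2"
  have y: "?y > 0" "?y \<le> ?n" using R card_lattice_disc_ge[of R] by auto
  have "2 * A * ?n + (1 + \<eta>) * 4 * pi\<^sup>2 * (\<Sum>v\<in>lattice_disc R. (norm (real_vec v))\<^sup>2) \<le>
      2 * A * ?n + (1 + \<eta>) * 4 * pi\<^sup>2 * (pi * ?P)"
    using assms by (intro add_left_mono mult_left_mono sum_norm_sq_le) auto
  \<comment> \<open>Factors n / y \<ge> 1 are inserted so that every term becomes a multiple of
    n^2.\<close>
  also have "\<dots> \<le> 2 * A * ?n * (?n / ?y) + (1 + \<eta>) * 4 * pi\<^sup>2 * (pi * ?P) * (?n / ?y)\<^sup>2"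
  proof (rule add_mono)
    have "?n / ?y \<ge> 1" using y by simp
    then have "(?n / ?y)\<^sup>2 \<ge> 1" by simp
    then show "(1 + \<eta>) * 4 * pi\<^sup>2 * (pi * ?P) \<le> (1 + \<eta>) * 4 * pi\<^sup>2 * (pi * ?P) * (?n / ?y)\<^sup>2"
      using assms mult_left_mono[of 1 "(?n / ?y)\<^sup>2" "(1 + \<eta>) * 4 * pi\<^sup>2 * (pi * ?P)"] by simp
    show "2 * A * ?n \<le> 2 * A * ?n * (?n / ?y)"
      using \<open>?n / ?y \<ge> 1\<close> assms mult_left_mono[of 1 "?n / ?y" "2 * A * ?n"] by simp
  qed
  also have "\<dots> = ?X R * ?n\<^sup>2"
  proof -
    have "2 * A * m * (m / (pi * z\<^sup>2)) + (1 + \<eta>) * 4 * pi\<^sup>2 * (pi * P) * (m / (pi * z\<^sup>2))\<^sup>2 =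
        (2 * A / (pi * z\<^sup>2) + (1 + \<eta>) * 4 * pi * P / z ^ 4) * m\<^sup>2" if "z \<noteq> 0" for m z P :: real
      using that by (simp add: field_simps power2_eq_square power4_eq_xxxx)
    then show ?thesis using R by simp
  qed
  also have "\<dots> \<le> 2 * pi * (1 + 2 * \<eta>) * ?n\<^sup>2" using R by (intro mult_right_mono) auto
  finally show ?thesis using R by blast
qed

text \<open>The largest admissible scale works: admissible scales are bounded by \<open>N\<close>,
  and \<open>l0\<close> is one of them.\<close>

lemma square_scale_exists:
  fixes n B l0 N :: nat
  assumes "n > 0" "B > 0" "n * (B * l0)\<^sup>2 \<le> N"
  shows "\<exists>l\<ge>l0. n * (B * l)\<^sup>2 \<le> N \<and> N < n * (B * (l + 1))\<^sup>2"
proof -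
  let ?P = "\<lambda>l. n * (B * l)\<^sup>2 \<le> N"
  have "l \<le> N" if "?P l" for l
  proof -
    have "l \<le> (B * l)\<^sup>2" using assms(2) by (simp add: power2_eq_square)
    also have "\<dots> \<le> n * (B * l)\<^sup>2" using assms(1) by simp
    finally show ?thesis using that by simp
  qed
  then obtain l where "?P l" "\<forall>k. ?P k \<longrightarrow> k \<le> l"
    using ex_has_greatest_nat[of ?P l0 id "Suc N"] assms(3) by (auto simp: less_Suc_eq_le)
  moreover from this have "\<not> ?P (l + 1)" by fastforce
  ultimately show ?thesis using assms(3) by (intro exI[of _ l]) auto
qed

text \<open>Order of the choices: \<eta> and B from \<epsilon>, then A and the orbitals from \<eta>,
  then R; so n, c and K are constants when the scale l tends to infinity. Every large N lies between
  two consecutive scales.\<close>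

theorem proposition15:
  shows "limsup (\<lambda>N::nat. ennreal (ln (real N)) * kappa N) \<le> 4"
proof (rule ennreal_le_epsilon)
  fix \<epsilon> :: real assume \<epsilon>: "\<epsilon> > 0"
  \<comment> \<open>Gives 4 (1 + 2 \<eta>) = 4 + \<epsilon> / 2; the other half is reserved for the
    factor (B / (B - 2))^2, the loss at the boundary of the grid.\<close>
  define \<eta> where "\<eta> = \<epsilon> / 16"
  have \<eta>: "\<eta> > 0" using \<epsilon> by (simp add: \<eta>_def)
  have "(\<lambda>B::nat. (real B / (real B - 2))\<^sup>2 * (4 * (1 + 2 * \<eta>))) \<longlonglongrightarrow> 1 * (4 * (1 + 2 * \<eta>))"
    by (intro tendsto_mult tendsto_const) real_asymp
  moreover have "1 * (4 * (1 + 2 * \<eta>)) < 4 + \<epsilon>" using \<epsilon> by (simp add: \<eta>_def)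
  ultimately have "\<forall>\<^sub>F B in sequentially. (real B / (real B - 2))\<^sup>2 * (4 * (1 + 2 * \<eta>)) < 4 + \<epsilon>"
    by (rule order_tendstoD)
  then have "\<forall>\<^sub>F B in sequentially. B \<ge> 3 \<and> (real B / (real B - 2))\<^sup>2 * (4 * (1 + 2 * \<eta>)) < 4 + \<epsilon>"
    by (intro eventually_conj eventually_ge_at_top)
  then obtain B :: nat where B: "B \<ge> 3" "(real B / (real B - 2))\<^sup>2 * (4 * (1 + 2 * \<eta>)) < 4 + \<epsilon>"
    using eventually_happens'[OF sequentially_bot] by blast
  obtain A f where f: "orbital_family \<eta> A f"
    using orbital_family_exists[OF \<eta>] by blast
  have "0 \<le> (LBINT t. (norm (D1 (f 0) t))\<^sup>2)" by simp
  also have "\<dots> \<le> A" using f by (auto simp: orbital_family_def dest!: spec[of _ "0::int"])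
  finally have "A \<ge> 0" .
  then obtain R where "R \<ge> 3" and R: "2 * A * card (lattice_disc R) +
      (1 + \<eta>) * 4 * pi\<^sup>2 * (\<Sum>v\<in>lattice_disc R. (norm (real_vec v))\<^sup>2)
     \<le> 2 * pi * (1 + 2 * \<eta>) * (real (card (lattice_disc R)))\<^sup>2"
    using energy_density_limit[OF \<eta>] by blast
  define n where "n = card (lattice_disc R)"
  define S where "S = 2 * A * n + (1 + \<eta>) * 4 * pi\<^sup>2 * (\<Sum>v\<in>lattice_disc R. (norm (real_vec v))\<^sup>2)"
  have S: "S \<le> 2 * pi * (1 + 2 * \<eta>) * (real n)\<^sup>2" using R by (simp add: S_def n_def)
  have "0 < pi * (real R - 2)\<^sup>2" using \<open>R \<ge> 3\<close> by simp
  also have "\<dots> \<le> real n" unfolding n_def using \<open>R \<ge> 3\<close> by (intro card_lattice_disc_ge) simp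
  finally have n0: "n > 0" by simp
  define c where "c = real n * (real B)\<^sup>2"
  have c0: "c > 0" using n0 B by (simp add: c_def)
  define K where "K = 2 * (real B / (real B - 2))\<^sup>2 * S / (real n)\<^sup>2"
  define T where "T = (\<lambda>l::nat. pi * (2 * ln (real l) - 40) - 1/4)"
  \<comment> \<open>The logarithm, which dominates ln N, is 2 ln l to leading order and T l is 2 pi
    ln l, whence the limit 1 / pi.\<close>
  let ?rate = "\<lambda>l::nat. ln (c * (real l + 1)\<^sup>2) * ((real l + 1)\<^sup>2 / ((real l)\<^sup>2 * T l))"
  have "?rate \<longlonglongrightarrow> inverse pi"
    unfolding T_def using c0 by real_asymp
  then have "(\<lambda>l. ?rate l * K) \<longlonglongrightarrow> inverse pi * K" by (intro tendsto_mult tendsto_const)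
  moreover have "inverse pi * K < 4 + \<epsilon>"
  proof -
    have "S / (real n)\<^sup>2 \<le> 2 * pi * (1 + 2 * \<eta>)" using S n0 by (simp add: divide_le_eq)
    then have "inverse pi * (2 * (real B / (real B - 2))\<^sup>2) * (S / (real n)\<^sup>2) \<le>
        inverse pi * (2 * (real B / (real B - 2))\<^sup>2) * (2 * pi * (1 + 2 * \<eta>))"
      by (intro mult_left_mono) auto
    also have "\<dots> = (inverse pi * pi) * ((real B / (real B - 2))\<^sup>2 * (4 * (1 + 2 * \<eta>)))"
      by (simp only: mult_ac)
    also have "\<dots> = (real B / (real B - 2))\<^sup>2 * (4 * (1 + 2 * \<eta>))"
      by (subst left_inverse) simp_all
    finally show ?thesis using B(2) by (simp add: K_def)
  qed
  ultimately have "\<forall>\<^sub>F l in sequentially. ?rate l * K < 4 + \<epsilon>" by (rule order_tendstoD)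
  moreover have "\<forall>\<^sub>F l in sequentially. T l > 0" unfolding T_def by real_asymp
  moreover have "\<forall>\<^sub>F l::nat in sequentially. l \<ge> 1" by (rule eventually_ge_at_top)
  ultimately have "\<forall>\<^sub>F l in sequentially. ?rate l * K < 4 + \<epsilon> \<and> T l > 0 \<and> l \<ge> 1"
    by (intro eventually_conj)
  then obtain l0 where l0: "\<And>l. l \<ge> l0 \<Longrightarrow> ?rate l * K < 4 + \<epsilon> \<and> T l > 0 \<and> l \<ge> 1"
    by (auto simp: eventually_sequentially)
  have "ennreal (ln (real N)) * kappa N \<le> 4 + ennreal \<epsilon>" if N: "N \<ge> n * (B * l0)\<^sup>2" for N
  proof -
    obtain l where l: "l \<ge> l0" "n * (B * l)\<^sup>2 \<le> N" "N < n * (B * (l + 1))\<^sup>2"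
      using square_scale_exists[OF n0 _ N] B by auto
    have l': "?rate l * K < 4 + \<epsilon>" "T l > 0" "l \<ge> 1" using l0[OF l(1)] by auto
    have "n * (B * l)\<^sup>2 \<ge> 1" using n0 B l' by simp
    then have N1: "N \<ge> 1" using l(2) by linarith
    let ?Q = "(real B * (real l + 1))\<^sup>2 * S / ((real n)\<^sup>2 * ((real B - 2) * l)\<^sup>2 * T l / 2)"
    have Q: "?Q = (real l + 1)\<^sup>2 / ((real l)\<^sup>2 * T l) * K"
      by (simp add: K_def power_mult_distrib power_divide mult_ac)
    have kQ: "kappa N \<le> ennreal ?Q"
      using kappa_le_blocks[OF f n_def, of l B N] l l' B
      by (simp add: S_def T_def)
    have "real N \<le> c * (real l + 1)\<^sup>2"
    proof -
      have "real N \<le> real (n * (B * (l + 1))\<^sup>2)" using l(3) by (intro of_nat_mono) simp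
      also have "\<dots> = c * (real l + 1)\<^sup>2" by (simp add: c_def power2_eq_square algebra_simps)
      finally show ?thesis .
    qed
    then have ln: "ln (real N) \<le> ln (c * (real l + 1)\<^sup>2)" using N1 by simp
    have ln0: "0 \<le> ln (real N)" using N1 by simp
    show ?thesis
    \<comment> \<open>The sign of S has not been established; a negative \<open>?Q\<close> is sent
      to 0 by \<open>ennreal\<close>, and the bound then forces \<open>kappa N = 0\<close>.\<close>
    proof (cases "?Q \<ge> 0")
      case True
      have "ennreal (ln (real N)) * kappa N \<le> ennreal (ln (real N)) * ennreal ?Q"
        by (intro mult_left_mono kQ) simp
      also have "\<dots> = ennreal (ln (real N) * ?Q)" by (rule ennreal_mult[OF ln0 True, symmetric])
      also have "ln (real N) * ?Q \<le> ln (c * (real l + 1)\<^sup>2) * ?Q"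
        by (intro mult_right_mono ln True)
      also have "\<dots> = ?rate l * K" unfolding Q by simp
      also have "\<dots> \<le> 4 + \<epsilon>" using l' by simp
      also have "ennreal (4 + \<epsilon>) = 4 + ennreal \<epsilon>" using \<epsilon> by simp
      finally show ?thesis by (simp add: ennreal_leI)
    next
      case False
      then have "kappa N = 0" using kQ by (simp add: ennreal_neg)
      then show ?thesis by simp
    qed
  qed
  then have "\<forall>\<^sub>F N in sequentially. ennreal (ln (real N)) * kappa N \<le> 4 + ennreal \<epsilon>"
    by (auto simp: eventually_sequentially)
  then show "limsup (\<lambda>N. ennreal (ln (real N)) * kappa N) \<le> 4 + ennreal \<epsilon>"
    by (rule Limsup_bounded)
qed

end
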